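(* Let $X$ be a Hausdorff locally convex space, $(T,\Sigma,\mu)$ a complete $\sigma$-finite measure space, and $f:T\times X\to\overline{\mathbb{R}}$ a convex normal integrand, $f_t:=f(t,\cdot)$. Assume that either $X$ is a Suslin space, or $(T,\Sigma)=(\mathbb{N},\mathcal{P}(\mathbb{N}))$. If each one of the functions $I_f$ and $f(t,\cdot)$, $t\in T$, is continuous at some point, then for every $x\in X$ and $\varepsilon\ge0$ $$\partial_\varepsilon I_f(x)=\bigcup_{\substack{\varepsilon=\varepsilon_1+\varepsilon_2\\ \varepsilon_1,\varepsilon_2\ge0\\ \ell\in\mathcal{I}(\varepsilon_1)}}\left\{(w)\text{-}\int_T\partial_{\ell(t)}f_t(x)\,d\mu(t)+N^{\varepsilon_2}_{\operatorname{dom}I_f}(x)\right\}.$$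
   Context: $X^*$ is the topological dual of $X$, with pairing $\langle\cdot,\cdot\rangle$. Conventions: $0\cdot(\pm\infty)=0$, $\infty+(-\infty)=(-\infty)+\infty=\infty$. A Hausdorff topological space is Suslin if it is the continuous image of a Polish space. Upper integral: for $h:T\to\overline{\mathbb{R}}$, $\int_T h\,d\mu:=\inf\{\int_T g\,d\mu: g\in L^1(T,\mathbb{R}),\ h\le g\ \mu\text{-a.e.}\}$, equal to $+\infty$ if there is no such $g$. The integral function is $I_f(x):=\int_T f(t,x)\,d\mu(t)$, $x\in X$, and $\operatorname{dom}I_f=\{x:I_f(x)<+\infty\}$. $f:T\times X\to\overline{\mathbb{R}}$ is a convex normal integrand if it is $\Sigma\otimes\mathcal{B}(X)$-measurable and $f(t,\cdot)$ is lower semicontinuous, convex and proper for a.e. $t$. "Continuous at a point" means finite and continuous there. For $h:X\to\overline{\mathbb{R}}$ and $\varepsilon\ge0$: if $h(x)\in\mathbb{R}$, $\partial_\varepsilon h(x):=\{x^*\in X^*:\langle x^*,y-x\rangle\le h(y)-h(x)+\varepsilon\ \forall y\in X\}$; if $h(x)\notin\mathbb{R}$, $\partial_\varepsilon h(x):=\emptyset$. For $A\subset X$, $N_A^\varepsilon(x):=\partial_\varepsilon\delta_A(x)$, where $\delta_A$ is the indicator function ($0$ on $A$, $+\infty$ off $A$). For $\eta\ge0$, $\mathcal{I}(\eta):=\{\ell\in L^1(T,\mathbb{R}_+):\int_T\ell\,d\mu\le\eta\}$. A function $m:T\to X^*$ is $w^*$-integrable if $t\mapsto\langle m(t),x\rangle$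 is integrable for every $x\in X$; its weak integral $\int_T m\,d\mu$ is the linear map $x\mapsto\int_T\langle m(t),x\rangle d\mu(t)$ (not necessarily continuous). For a multifunction $G:T\rightrightarrows X^*$, $(w)\text{-}\int_T G(t)\,d\mu(t):=\{\int_T m\,d\mu\in X^*: m\text{ is }w^*\text{-integrable and }m(t)\in G(t)\text{ a.e.}\}$. *)

theory Defs
  imports "HOL-Analysis.Analysis" "HOL-Library.Function_Algebras" "HOL-Library.Set_Algebras"
begin

class hausdorff_locally_convex = real_vector + topological_ab_group_add + t2_space +
  assumes tendsto_scaleR_nhds:
    "filterlim (\<lambda>p. fst p *\<^sub>R snd p) (nhds (c *\<^sub>R x)) (nhds (c :: real) \<times>\<^sub>F nhds x)"
  and locally_convex_nhds_0:
    "open U \<Longrightarrow> 0 \<in> U \<Longrightarrow> \<exists>V. open V \<and> 0 \<in> V \<and> V \<subseteq> U \<and>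
       (\<forall>x\<in>V. \<forall>y\<in>V. \<forall>u\<ge>0. \<forall>v\<ge>0. u + v = 1 \<longrightarrow> u *\<^sub>R x + v *\<^sub>R y \<in> V)"
  \<comment> \<open>the last conjunct is convexity of \<open>V\<close>; the constant \<open>convex\<close> cannot be written inside the class declaration\<close>

lemma locally_convex_nhds_0_convex:
  fixes U :: "'a::hausdorff_locally_convex set"
  assumes "open U" "0 \<in> U"
  shows "\<exists>V. open V \<and> convex V \<and> 0 \<in> V \<and> V \<subseteq> U"
  using locally_convex_nhds_0[OF assms] unfolding convex_def by blast

instance real_normed_vector \<subseteq> hausdorff_locally_convex
proof
  fix c :: real and x :: 'a
  show "filterlim (\<lambda>p. fst p *\<^sub>R snd p) (nhds (c *\<^sub>R x)) (nhds c \<times>\<^sub>F nhds x)"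
    by (intro tendsto_scaleR filterlim_fst filterlim_snd)
next
  fix U :: "'a set"
  assume "open U" "0 \<in> U"
  then obtain e where "e > 0" "ball 0 e \<subseteq> U"
    using open_contains_ball by blast
  then show "\<exists>V. open V \<and> 0 \<in> V \<and> V \<subseteq> U \<and>
      (\<forall>x\<in>V. \<forall>y\<in>V. \<forall>u\<ge>0. \<forall>v\<ge>0. u + v = 1 \<longrightarrow> u *\<^sub>R x + v *\<^sub>R y \<in> V)"
    using convex_ball[of "0 :: 'a" e]
    by (intro exI[of _ "ball 0 e"]) (auto simp: convex_def simp del: mem_ball_0)
qed

text \<open>
  Every Polish space has at most the cardinality of the continuum, so it has a homeomorphic
  copy whose underlying set consists of real numbers. Hence it suffices to quantify over arbitrary
  Polish topologies on sets of reals; these are unrelated to the usual topology of the reals.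
\<close>

definition suslin_space :: "'a::t2_space itself \<Rightarrow> bool" where
  "suslin_space _ \<longleftrightarrow>
     (\<exists>(P :: real topology) (g :: real \<Rightarrow> 'a).
        completely_metrizable_space P \<and> separable_space P \<and>
        continuous_map P euclidean g \<and> g ` topspace P = UNIV)"

text \<open>
  The measurable space underlying \<open>M\<close> is \<open>(\<nat>, \<P>(\<nat>))\<close>, up to the naming of the points.
\<close>

definition is_nat_power_set_space :: "'t measure \<Rightarrow> bool" where
  "is_nat_power_set_space M \<longleftrightarrow>
     (\<exists>e :: nat \<Rightarrow> 't. bij_betw e UNIV (space M)) \<and> sets M = Pow (space M)"

text \<open>
  In \<^typ>\<open>ereal\<close> we have \<open>0 * (\<plusminus>\<infinity>) = 0\<close> and \<open>\<infinity> + (-\<infinity>) = (-\<infinity>) + \<infinity> = \<infinity>\<close>.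
\<close>

definition ereal_convex :: "('a::real_vector \<Rightarrow> ereal) \<Rightarrow> bool" where
  "ereal_convex h \<longleftrightarrow>
     (\<forall>x y. \<forall>u\<in>{0..1::real}.
        h ((1 - u) *\<^sub>R x + u *\<^sub>R y) \<le> ereal (1 - u) * h x + ereal u * h y)"

definition proper :: "('a \<Rightarrow> ereal) \<Rightarrow> bool" where
  "proper h \<longleftrightarrow> (\<forall>x. h x \<noteq> -\<infinity>) \<and> (\<exists>x. h x \<noteq> \<infinity>)"

definition lower_semicontinuous :: "('a::topological_space \<Rightarrow> ereal) \<Rightarrow> bool" where
  "lower_semicontinuous h \<longleftrightarrow> (\<forall>x. \<forall>a < h x. \<forall>\<^sub>F y in nhds x. a < h y)"

definition continuous_at_some_point :: "('a::t2_space \<Rightarrow> ereal) \<Rightarrow> bool" where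
  "continuous_at_some_point h \<longleftrightarrow> (\<exists>x. \<bar>h x\<bar> \<noteq> \<infinity> \<and> isCont h x)"

definition convex_normal_integrand ::
    "'t measure \<Rightarrow> ('t \<Rightarrow> 'a::{real_vector, topological_space} \<Rightarrow> ereal) \<Rightarrow> bool" where
  "convex_normal_integrand M f \<longleftrightarrow>
     case_prod f \<in> borel_measurable (M \<Otimes>\<^sub>M borel) \<and>
     (AE t in M. lower_semicontinuous (f t) \<and> ereal_convex (f t) \<and> proper (f t))"

definition upper_integral :: "'t measure \<Rightarrow> ('t \<Rightarrow> ereal) \<Rightarrow> ereal" where
  "upper_integral M h =
     Inf {ereal (LINT t|M. g t) | g :: 't \<Rightarrow> real.
            integrable M g \<and> (AE t in M. h t \<le> ereal (g t))}"

definition integral_function :: "'t measure \<Rightarrow> ('t \<Rightarrow> 'a \<Rightarrow> ereal) \<Rightarrow> 'a \<Rightarrow> ereal" where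
  "integral_function M f x = upper_integral M (\<lambda>t. f t x)"

definition effective_domain :: "('a \<Rightarrow> ereal) \<Rightarrow> 'a set" where
  "effective_domain h = {x. h x < \<infinity>}"

definition topological_dual :: "('a::{real_vector, topological_space} \<Rightarrow> real) set" where
  "topological_dual = {\<phi>. linear \<phi> \<and> continuous_on UNIV \<phi>}"

definition eps_subdifferential ::
    "real \<Rightarrow> ('a::{real_vector, topological_space} \<Rightarrow> ereal) \<Rightarrow> 'a \<Rightarrow> ('a \<Rightarrow> real) set" where
  "eps_subdifferential \<epsilon> h x =
     (if \<bar>h x\<bar> \<noteq> \<infinity>
      then {\<phi> \<in> topological_dual. \<forall>y. ereal (\<phi> (y - x)) \<le> h y - h x + ereal \<epsilon>}
      else {})"

definition set_indicator :: "'a set \<Rightarrow> 'a \<Rightarrow> ereal" where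
  "set_indicator A x = (if x \<in> A then 0 else \<infinity>)"

definition eps_normal_set ::
    "real \<Rightarrow> 'a::{real_vector, topological_space} set \<Rightarrow> 'a \<Rightarrow> ('a \<Rightarrow> real) set" where
  "eps_normal_set \<epsilon> A x = eps_subdifferential \<epsilon> (set_indicator A) x"

definition nonneg_integrable_upto :: "'t measure \<Rightarrow> real \<Rightarrow> ('t \<Rightarrow> real) set" where
  "nonneg_integrable_upto M \<eta> =
     {l. integrable M l \<and> (\<forall>t\<in>space M. 0 \<le> l t) \<and> (LINT t|M. l t) \<le> \<eta>}"

definition weak_star_integrable ::
    "'t measure \<Rightarrow> ('t \<Rightarrow> 'a::{real_vector, topological_space} \<Rightarrow> real) \<Rightarrow> bool" where
  "weak_star_integrable M m \<longleftrightarrow>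
     (\<forall>t\<in>space M. m t \<in> topological_dual) \<and> (\<forall>x. integrable M (\<lambda>t. m t x))"

definition weak_integral :: "'t measure \<Rightarrow> ('t \<Rightarrow> 'a \<Rightarrow> real) \<Rightarrow> 'a \<Rightarrow> real" where
  "weak_integral M m = (\<lambda>x. LINT t|M. m t x)"

definition weak_set_integral ::
    "'t measure \<Rightarrow> ('t \<Rightarrow> ('a::{real_vector, topological_space} \<Rightarrow> real) set) \<Rightarrow> ('a \<Rightarrow> real) set"
  where
  "weak_set_integral M G =
     {weak_integral M m | m.
        weak_star_integrable M m \<and> (AE t in M. m t \<in> G t) \<and>
        weak_integral M m \<in> topological_dual}"

end

theory Submission
  imports Defs
begin

text \<open>
  Let \<open>\<phi>\<close> be an \<open>\<epsilon>\<close>-subgradient of \<open>I\<^sub>f\<close> at \<open>x\<close>. Viewing \<open>X\<close> as the constants in a space of maps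
  \<open>w : T \<rightarrow> X\<close>, the Hahn-Banach theorem extends \<open>\<phi>\<close> to a linear \<open>\<Phi>\<close> with
  \<open>\<Phi>(w) \<le> \<integral> (f\<^sub>t(x + w(t)) - f\<^sub>t(x)) d\<mu> + \<epsilon>\<close>. Let \<open>E(A)\<close> be the supremum of
  \<open>\<Phi>(w) - \<integral> (f\<^sub>t(x + w(t)) - f\<^sub>t(x)) d\<mu>\<close> over the \<open>w\<close> supported in \<open>A\<close>. Then \<open>E\<close> is a nonnegative
  finitely additive set function of mass at most \<open>\<epsilon>\<close>, and \<open>\<lambda>\<^sub>u(A) = \<Phi>(1\<^sub>A u)\<close> satisfies
  \<open>\<lambda>\<^sub>u(A) \<le> \<integral>\<^sub>A (f\<^sub>t(x + u) - f\<^sub>t(x)) d\<mu> + E(A)\<close>. Passing to countably additive parts (Yosida-Hewitt) and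
  densities turns \<open>E\<close> into \<open>\<ell>\<close> and \<open>\<lambda>\<^sub>u\<close> into \<open>t \<mapsto> \<langle>m(t), u\<rangle>\<close> with \<open>m(t) \<in> \<partial>\<^bsub>\<ell>(t)\<^esub> f\<^sub>t(x)\<close>, while the purely
  finitely additive remainder of \<open>u \<mapsto> \<lambda>\<^sub>u(T)\<close> is bounded on \<open>dom I\<^sub>f - x\<close> by that of \<open>E(T)\<close> and so is an
  \<open>\<epsilon>\<^sub>2\<close>-normal. The densities determine \<open>m(t)\<close> only up to a null set for each \<open>u\<close>; continuity of \<open>f\<^sub>t\<close> at
  some point makes their restriction to a countable dense rational subspace extend to a continuous
  functional. The converse inclusion follows by integrating the subgradient inequalities.
\<close>

subsection \<open>Continuous linear functionals\<close>

text \<open>One charge E serves all directions u, and this is why a single \<ell> fits every u. The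
  set functions \<open>\<lambda>\<^sub>u\<close> have no sign, so their countably additive parts are
  not taken directly: for an integrable majorant g of
  \<open>f\<^sub>t(x + u) - f\<^sub>t(x)\<close>, the set function \<open>A \<mapsto>
  \<integral>\<^sub>A g d\<mu> + E(A) - \<lambda>\<^sub>u(A)\<close> is nonnegative, additive and
  zero on null sets. Its density yields that of \<open>\<lambda>\<^sub>u\<close> by subtraction, and
  the nonnegative mass that it loses in passing to the density is what bounds the remainder of
  \<phi> by that of E. Such g exist for x + u near a continuity point of \<open>I\<^sub>f\<close>;
  other u are reached by differences. For a general u, \<open>f\<^sub>t(x + u)\<close> may be
  infinite or non-integrable, so pointwise inequalities are derived on sets where it is bounded by a
  multiple of a positive integrable function. The inequality for m(t) on the dense subspace does not
  extend by lower semicontinuity, which points the wrong way; convexity and an upper bound of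
  \<open>f\<^sub>t\<close> near its continuity point take its place.\<close>

lemma tendsto_scaleR_lc:
  fixes g :: "'b \<Rightarrow> 'a::hausdorff_locally_convex"
  assumes "(f \<longlongrightarrow> a) F" "(g \<longlongrightarrow> b) F"
  shows "((\<lambda>x. f x *\<^sub>R g x) \<longlongrightarrow> a *\<^sub>R b) F"
  using filterlim_compose[OF tendsto_scaleR_nhds filterlim_Pair[OF assms]] by simp

lemma tendsto_perturb_scaleR:
  fixes z :: "'a::hausdorff_locally_convex"
  assumes "(g \<longlongrightarrow> 0) F"
  shows "((\<lambda>v. z + r *\<^sub>R g v) \<longlongrightarrow> z) F"
proof -
  have "((\<lambda>v. z + r *\<^sub>R g v) \<longlongrightarrow> z + r *\<^sub>R 0) F"
    by (intro tendsto_add tendsto_const tendsto_scaleR_lc assms)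
  then show ?thesis by simp
qed

lemma eventually_in_open:
  assumes "(g \<longlongrightarrow> z) F" "open U" "z \<in> U"
  shows "\<forall>\<^sub>F x in F. g x \<in> U"
  using assms topological_tendstoD by blast

text \<open>A bound near z controls \<open>\<phi> (z + v)\<close> and \<open>\<phi> (z - v)\<close>
  at once, hence \<open>\<bar>\<phi> v\<bar>\<close> for small v; blowing v up by the factor
  \<open>C / e\<close> turns this into continuity.\<close>

lemma linear_in_dual_if_bounded_above:
  fixes \<phi> :: "'a::hausdorff_locally_convex \<Rightarrow> real"
  assumes lin: "linear \<phi>" and U: "open U" "z \<in> U" and bd: "\<And>y. y \<in> U \<Longrightarrow> \<phi> y \<le> c"
  shows "\<phi> \<in> topological_dual"
proof -
  interpret linear \<phi> by fact
  \<comment> \<open>The summand 1 makes \<open>C\<close> positive even when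
    \<open>c = \<phi> z\<close>.\<close>
  define C where "C = c - \<phi> z + 1"
  have C: "C > 0" using bd[OF U(2)] by (simp add: C_def)
  have "isCont \<phi> x" for x
  proof -
    have "(\<phi> \<longlongrightarrow> \<phi> x) (nhds x)"
    proof (rule tendstoI)
      fix e :: real assume e: "e > 0"
      have "((\<lambda>y. y) \<longlongrightarrow> x) (nhds x)" by (simp add: filterlim_ident)
      then have lim: "((\<lambda>y. y - x) \<longlongrightarrow> 0) (nhds x)"
        using tendsto_diff[OF _ tendsto_const, of "\<lambda>y. y" x "nhds x" x] by simp
      show "\<forall>\<^sub>F y in nhds x. dist (\<phi> y) (\<phi> x) < e"
        using eventually_in_open[OF tendsto_perturb_scaleR[OF lim, of z "C / e"] U]
              eventually_in_open[OF tendsto_perturb_scaleR[OF lim, of z "- (C / e)"] U]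
      proof eventually_elim
        case (elim y)
        have "\<phi> z + C / e * \<phi> (y - x) \<le> c" "\<phi> z - C / e * \<phi> (y - x) \<le> c"
          using bd[OF elim(1)] bd[OF elim(2)] by (simp_all add: add diff scale)
        then have "C / e * \<bar>\<phi> (y - x)\<bar> < C"
          using C e by (auto simp: C_def abs_if)
        then have "\<bar>\<phi> (y - x)\<bar> < e"
          using C e by (simp add: field_simps)
        then show ?case by (simp add: dist_real_def diff)
      qed
    qed
    then show ?thesis
      by (simp add: isCont_def tendsto_at_iff_tendsto_nhds)
  qed
  then show ?thesis
    using lin by (simp add: topological_dual_def continuous_at_imp_continuous_on)
qed

section \<open>Rational-linear functions on dense rational subspaces\<close>

definition rat_subspace :: "'a::real_vector set \<Rightarrow> bool" where
  "rat_subspace D \<longleftrightarrow> (\<forall>d\<in>D. \<forall>d'\<in>D. d + d' \<in> D) \<and> (\<forall>q\<in>\<rat>. \<forall>d\<in>D. q *\<^sub>R d \<in> D)"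

definition dense_set :: "'a::topological_space set \<Rightarrow> bool" where
  "dense_set D \<longleftrightarrow> (\<forall>U. open U \<longrightarrow> U \<noteq> {} \<longrightarrow> D \<inter> U \<noteq> {})"

definition rat_linear_on :: "'a::real_vector set \<Rightarrow> ('a \<Rightarrow> real) \<Rightarrow> bool" where
  "rat_linear_on D G \<longleftrightarrow> (\<forall>d\<in>D. \<forall>d'\<in>D. G (d + d') = G d + G d') \<and> (\<forall>q\<in>\<rat>. \<forall>d\<in>D. G (q *\<^sub>R d) = q * G d)"

text \<open>Boundedness above near one point makes G small on D near 0, so G has a limit along D at
  every point of X; linearity and the bound pass to the limit. Filters are used because X need not
  be first countable.\<close>

lemma rat_linear_extends_to_dual:
  fixes D :: "'a::hausdorff_locally_convex set"
  assumes D: "rat_subspace D" "dense_set D" and G: "rat_linear_on D G"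
    and U: "open U" "U \<noteq> {}" and bd: "\<And>d. d \<in> D \<Longrightarrow> d \<in> U \<Longrightarrow> G d \<le> c"
  shows "\<exists>m\<in>topological_dual. \<forall>d\<in>D. m d = G d"
proof -
  obtain d0 where d0: "d0 \<in> D" "d0 \<in> U"
    using D(2) U unfolding dense_set_def by blast
  \<comment> \<open>\<open>F u\<close> is the trace on D of the neighbourhood filter of u; density
    of D makes it proper.\<close>
  define F where "F = (\<lambda>u::'a. inf (nhds u) (principal D))"
  have Feq: "F u = inf (nhds u) (principal D)" for u by (simp add: F_def)
  define C where "C = c - G d0 + 1"
  have C: "C > 0" using bd[OF d0] by (simp add: C_def)
  have Dadd: "d + d' \<in> D" "G (d + d') = G d + G d'" if "d \<in> D" "d' \<in> D" for d d'
    using D(1) G that by (auto simp: rat_subspace_def rat_linear_on_def)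
  have Dscale: "q *\<^sub>R d \<in> D" "G (q *\<^sub>R d) = q * G d" if "d \<in> D" "q \<in> \<rat>" for d q
    using D(1) G that by (auto simp: rat_subspace_def rat_linear_on_def)
  have Dneg: "- d \<in> D" "G (- d) = - G d" if "d \<in> D" for d
    using Dscale[OF that, of "-1"] by auto
  have Ddiff: "d - d' \<in> D" "G (d - d') = G d - G d'" if "d \<in> D" "d' \<in> D" for d d'
    using Dadd[OF that(1) Dneg(1)[OF that(2)]] Dneg(2)[OF that(2)] by auto
  have Gbd: "\<bar>G d\<bar> < C" if "d \<in> D" "d0 + d \<in> U" "d0 - d \<in> U" for d
    using bd[OF Dadd(1)[OF d0(1) that(1)] that(2)] bd[OF Ddiff(1)[OF d0(1) that(1)] that(3)]
      Dadd(2)[OF d0(1) that(1)] Ddiff(2)[OF d0(1) that(1)]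
    by (auto simp: C_def abs_if)
  have Fnb: "F u \<noteq> bot" for u
    unfolding F_def using D(2)
    by (auto simp: dense_set_def trivial_limit_def eventually_inf_principal eventually_nhds)
  have evD: "\<forall>\<^sub>F d in F u. d \<in> D" for u
    unfolding F_def by (simp add: eventually_inf_principal)
  have Flim: "((\<lambda>d. d) \<longlongrightarrow> u) (F u)" for u
    unfolding F_def filterlim_def by simp
  \<comment> \<open>Points of D that approach the same vector have nearly equal G-values. Hence G is
    Cauchy along \<open>F u\<close>, and on D it agrees with its limit.\<close>
  have small: "\<forall>\<^sub>F i in H. \<bar>G (a i) - G (b i)\<bar> < e"
    if e: "e > 0" and lim: "(a \<longlongrightarrow> u) H" "(b \<longlongrightarrow> u) H"
      and ab: "\<forall>\<^sub>F i in H. a i \<in> D" "\<forall>\<^sub>F i in H. b i \<in> D" for a b u H e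
  proof -
    have "((\<lambda>i. a i - b i) \<longlongrightarrow> 0) H" using tendsto_diff[OF lim] by simp
    then have l: "((\<lambda>i. d0 + r *\<^sub>R (a i - b i)) \<longlongrightarrow> d0) H" for r
      by (rule tendsto_perturb_scaleR)
    \<comment> \<open>A rational factor above \<open>C / e\<close>, because G is homogeneous only
      over the rationals.\<close>
    obtain q where q: "q \<in> \<rat>" "C / e < q" using reals_Archimedean2[of "C / e"] Rats_of_nat by blast
    have "q > 0" using C e q(2) by (smt (verit) divide_pos_pos)
    show ?thesis
      using eventually_in_open[OF l[of q] U(1) d0(2)] eventually_in_open[OF l[of "-q"] U(1) d0(2)] ab
    proof eventually_elim
      case (elim i)
      have "\<bar>G (q *\<^sub>R (a i - b i))\<bar> < C"
        using elim Gbd[OF Dscale(1)[OF Ddiff(1) q(1)]] by simp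
      then have "q * \<bar>G (a i) - G (b i)\<bar> < C"
        using elim Dscale(2)[OF Ddiff(1) q(1)] Ddiff(2) \<open>q > 0\<close> by (simp add: abs_mult)
      also have "C < q * e" using q(2) e by (simp add: field_simps)
      finally show ?case using \<open>q > 0\<close> by simp
    qed
  qed
  have "\<exists>L. (G \<longlongrightarrow> L) (F u)" for u
  proof -
    have "cauchy_filter (filtermap G (F u))"
      unfolding cauchy_filter_metric_filtermap
    proof (intro allI impI)
      fix e :: real assume "e > 0"
      have "\<forall>\<^sub>F p in F u \<times>\<^sub>F F u. \<bar>G (fst p) - G (snd p)\<bar> < e"
        using small[OF \<open>e > 0\<close>, of fst u "F u \<times>\<^sub>F F u" snd] Flim evD
        by (simp add: filterlim_compose[OF Flim filterlim_fst] filterlim_compose[OF Flim filterlim_snd]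
              eventually_prod1 eventually_prod2 Fnb split_beta' case_prod_beta
              eventually_compose_filterlim[OF evD filterlim_fst] eventually_compose_filterlim[OF evD filterlim_snd])
      then obtain Pf Pg where P: "eventually Pf (F u)" "eventually Pg (F u)"
          "\<And>x y. Pf x \<Longrightarrow> Pg y \<Longrightarrow> \<bar>G x - G y\<bar> < e"
        unfolding eventually_prod_filter by auto
      show "\<exists>P. eventually P (F u) \<and> (\<forall>x y. P x \<and> P y \<longrightarrow> dist (G x) (G y) < e)"
        using eventually_conj[OF P(1,2)] P(3) unfolding dist_real_def by blast
    qed
    then have "\<exists>c. filtermap G (F u) \<le> nhds c"
      using cauchy_filter_complete_converges[of "filtermap G (F u)" UNIV] Fnb
      by (simp add: complete_UNIV filtermap_bot_iff)
    then show ?thesis by (simp add: filterlim_def)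
  qed
  then obtain m where m: "\<And>u. (G \<longlongrightarrow> m u) (F u)" by metis
  have "m d = G d" if "d \<in> D" for d
  proof -
    have "(G \<longlongrightarrow> G d) (F d)"
      by (rule tendstoI) (simp add: dist_real_def small[OF _ Flim tendsto_const evD] that)
    then show ?thesis using tendsto_unique[OF Fnb] m by blast
  qed
  moreover have "linear m"
  proof (rule linearI)
    fix u v
    have "((\<lambda>p. fst p + snd p) \<longlongrightarrow> u + v) (F u \<times>\<^sub>F F v)"
      by (intro tendsto_add filterlim_compose[OF Flim filterlim_fst] filterlim_compose[OF Flim filterlim_snd])
    moreover have ev: "\<forall>\<^sub>F p in F u \<times>\<^sub>F F v. fst p \<in> D \<and> snd p \<in> D"
      by (intro eventually_conj eventually_compose_filterlim[OF evD filterlim_fst]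
          eventually_compose_filterlim[OF evD filterlim_snd])
    ultimately have "filterlim (\<lambda>p. fst p + snd p) (F (u + v)) (F u \<times>\<^sub>F F v)"
      unfolding Feq[of "u + v"] filterlim_inf filterlim_principal
      by (auto elim!: eventually_mono simp: Dadd)
    then have 1: "((\<lambda>p. G (fst p + snd p)) \<longlongrightarrow> m (u + v)) (F u \<times>\<^sub>F F v)"
      by (rule filterlim_compose[OF m])
    have "((\<lambda>p. G (fst p) + G (snd p)) \<longlongrightarrow> m u + m v) (F u \<times>\<^sub>F F v)"
      by (intro tendsto_add filterlim_compose[OF m filterlim_fst] filterlim_compose[OF m filterlim_snd])
    then have 2: "((\<lambda>p. G (fst p + snd p)) \<longlongrightarrow> m u + m v) (F u \<times>\<^sub>F F v)"
      by (rule Lim_transform_eventually) (use ev in \<open>auto elim!: eventually_mono simp: Dadd\<close>)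
    show "m (u + v) = m u + m v"
      using tendsto_unique[OF _ 1 2] Fnb by (simp add: prod_filter_eq_bot)
  next
    fix r u
    \<comment> \<open>Rationals tending to r: real homogeneity is a limit over pairs of a rational
      and a point of D.\<close>
    define R where "R = inf (nhds r) (principal (\<rat> :: real set))"
    have Rnb: "R \<noteq> bot"
    proof
      assume "R = bot"
      then obtain e where e: "e > 0" "\<And>q. dist q r < e \<Longrightarrow> q \<notin> \<rat>"
        unfolding R_def trivial_limit_def eventually_inf_principal eventually_nhds_metric by auto
      obtain q where "q \<in> \<rat>" "r < q" "q < r + e" using Rats_dense_in_real[of r "r + e"] e(1) by auto
      then show False using e(2)[of q] by (simp add: dist_real_def)
    qed
    have Rlim: "((\<lambda>q. q) \<longlongrightarrow> r) R"
      unfolding R_def filterlim_def by simp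
    have evR: "\<forall>\<^sub>F q in R. q \<in> \<rat>" unfolding R_def by (simp add: eventually_inf_principal)
    have "((\<lambda>p. fst p *\<^sub>R snd p) \<longlongrightarrow> r *\<^sub>R u) (R \<times>\<^sub>F F u)"
      by (intro tendsto_scaleR_lc filterlim_compose[OF Flim filterlim_snd] filterlim_compose[OF Rlim filterlim_fst])
    moreover have ev: "\<forall>\<^sub>F p in R \<times>\<^sub>F F u. fst p \<in> \<rat> \<and> snd p \<in> D"
      by (intro eventually_conj eventually_compose_filterlim[OF evR filterlim_fst]
          eventually_compose_filterlim[OF evD filterlim_snd])
    ultimately have "filterlim (\<lambda>p. fst p *\<^sub>R snd p) (F (r *\<^sub>R u)) (R \<times>\<^sub>F F u)"
      unfolding Feq[of "r *\<^sub>R u"] filterlim_inf filterlim_principal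
      by (auto elim!: eventually_mono simp: Dscale)
    then have 1: "((\<lambda>p. G (fst p *\<^sub>R snd p)) \<longlongrightarrow> m (r *\<^sub>R u)) (R \<times>\<^sub>F F u)"
      by (rule filterlim_compose[OF m])
    have "((\<lambda>p. fst p * G (snd p)) \<longlongrightarrow> r * m u) (R \<times>\<^sub>F F u)"
      by (intro tendsto_mult filterlim_compose[OF Rlim filterlim_fst] filterlim_compose[OF m filterlim_snd])
    then have 2: "((\<lambda>p. G (fst p *\<^sub>R snd p)) \<longlongrightarrow> r * m u) (R \<times>\<^sub>F F u)"
      by (rule Lim_transform_eventually) (use ev in \<open>auto elim!: eventually_mono simp: Dscale\<close>)
    show "m (r *\<^sub>R u) = r *\<^sub>R m u"
      using tendsto_unique[OF _ 1 2] Fnb Rnb by (simp add: prod_filter_eq_bot)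
  qed
  moreover have "m u \<le> c" if "u \<in> U" for u
  proof (rule tendsto_upperbound[OF m])
    show "\<forall>\<^sub>F d in F u. G d \<le> c"
      using eventually_in_open[OF Flim U(1) that] evD by eventually_elim (rule bd)
  qed (rule Fnb)
  ultimately show ?thesis
    using linear_in_dual_if_bounded_above[OF _ U(1) d0(2), of m c] by blast
qed

lemma dual_eq_if_eq_on_dense:
  fixes D :: "'a::hausdorff_locally_convex set"
  assumes "m \<in> topological_dual" "m' \<in> topological_dual" "dense_set D" "\<And>d. d \<in> D \<Longrightarrow> m d = m' d"
  shows "m = m'"
proof (rule ccontr)
  assume "m \<noteq> m'"
  then obtain u where u: "m u \<noteq> m' u" by blast
  have "open {v. m v \<noteq> m' v}"
    using assms(1,2) by (intro open_Collect_neq) (auto simp: topological_dual_def)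
  then have "D \<inter> {v. m v \<noteq> m' v} \<noteq> {}" using assms(3) u unfolding dense_set_def by blast
  then show False using assms(4) by blast
qed

subsection \<open>The Hahn-Banach theorem on a subspace\<close>

definition sublinear_on :: "'b::real_vector set \<Rightarrow> ('b \<Rightarrow> real) \<Rightarrow> bool" where
  "sublinear_on S p \<longleftrightarrow> (\<forall>v\<in>S. \<forall>w\<in>S. p (v + w) \<le> p v + p w) \<and> (\<forall>c>0. \<forall>w\<in>S. p (c *\<^sub>R w) \<le> c * p w)"

text \<open>The inequalities for c and for its inverse give equality. At 0, subadditivity gives
  \<open>p 0 \<ge> 0\<close> and the factor 1/2 gives \<open>p 0 \<le> 0\<close>.\<close>

lemma sublinear_on_scale:
  assumes p: "sublinear_on S p" and S: "subspace S" and w: "w \<in> S" and c: "c \<ge> 0"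
  shows "p (c *\<^sub>R w) = c * p w"
proof (cases "c = 0")
  case True
  have "0 \<in> S" using S by (rule subspace_0)
  then have "p (0 + 0) \<le> p 0 + p 0" "p ((1/2) *\<^sub>R 0) \<le> (1/2) * p 0"
    using p unfolding sublinear_on_def by (blast, meson half_gt_zero zero_less_one)
  then show ?thesis using True by simp
next
  case False
  then have c: "c > 0" using c by simp
  have cw: "c *\<^sub>R w \<in> S" using S w by (simp add: subspace_scale)
  have "p (c *\<^sub>R w) \<le> c * p w" "p (inverse c *\<^sub>R (c *\<^sub>R w)) \<le> inverse c * p (c *\<^sub>R w)"
    using p w c cw unfolding sublinear_on_def by (blast, meson positive_imp_inverse_positive)
  then show ?thesis using c by (simp add: field_simps)
qed

lemma sublinear_on_neg:
  assumes p: "sublinear_on S p" and S: "subspace S" and w: "w \<in> S"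
  shows "- p (- w) \<le> p w"
proof -
  have "p (w + - w) \<le> p w + p (- w)"
    using p S w unfolding sublinear_on_def by (meson subspace_neg)
  moreover have "p 0 = 0" using sublinear_on_scale[OF p S w, of 0] by simp
  ultimately show ?thesis by simp
qed

text \<open>A minimal sublinear functional is linear, and Zorn's lemma provides one below \<open>q\<close>.\<close>

lemma hahn_banach_sublinear_on:
  fixes q :: "'b::real_vector \<Rightarrow> real"
  assumes q: "sublinear_on S q" and S: "subspace S"
  obtains \<Phi> where "\<And>w. w \<in> S \<Longrightarrow> \<Phi> w \<le> q w"
    and "\<And>v w. v \<in> S \<Longrightarrow> w \<in> S \<Longrightarrow> \<Phi> (v + w) = \<Phi> v + \<Phi> w"
    and "\<And>c w. w \<in> S \<Longrightarrow> \<Phi> (c *\<^sub>R w) = c * \<Phi> w"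
proof -
  \<comment> \<open>Values off S are frozen at 0; left free they could decrease without bound and
    nothing would be minimal.\<close>
  define A where "A = {p. sublinear_on S p \<and> (\<forall>w\<in>S. p w \<le> q w) \<and> (\<forall>w. w \<notin> S \<longrightarrow> p w = 0)}"
  \<comment> \<open>The order is reversed, so that the maximal element of Zorn's lemma is a minimal
    functional.\<close>
  define P :: "('b \<Rightarrow> real) \<Rightarrow> ('b \<Rightarrow> real) \<Rightarrow> bool" where "P = (\<lambda>a b. \<forall>w. b w \<le> a w)"
  note SS = subspace_add[OF S] subspace_scale[OF S] subspace_neg[OF S] subspace_0[OF S]
  have sub: "p (v + w) \<le> p v + p w" if "sublinear_on S p" "v \<in> S" "w \<in> S" for p v w
    using that by (simp add: sublinear_on_def)
  have po: "partial_order_on A (relation_of P A)"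
    by (rule partial_order_on_relation_ofI) (auto simp: P_def fun_eq_iff intro: order_trans antisym)
  have "\<exists>u\<in>A. \<forall>a\<in>C. P a u" if C: "C \<in> Chains (relation_of P A)" for C
  proof (cases "C = {}")
    case True
    have "(\<lambda>w. if w \<in> S then q w else 0) \<in> A"
      using q SS by (auto simp: A_def sublinear_on_def)
    then show ?thesis using True by blast
  next
    case False
    have CA: "C \<subseteq> A" and Ccmp: "\<And>p p'. p \<in> C \<Longrightarrow> p' \<in> C \<Longrightarrow> P p p' \<or> P p' p"
      using C by (auto simp: Chains_def relation_of_def)
    \<comment> \<open>The infimum of the chain, finite because every member lies above
      \<open>- q (- w)\<close>; comparability of any two members gives its subadditivity.\<close>
    define u where "u = (\<lambda>w. if w \<in> S then INF p\<in>C. p w else 0)"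
    have low: "- q (- w) \<le> p w" if "p \<in> C" "w \<in> S" for p w
    proof -
      have "p \<in> A" using that CA by blast
      then have "sublinear_on S p" "p (- w) \<le> q (- w)" using that SS by (auto simp: A_def)
      then show ?thesis using sublinear_on_neg[OF _ S that(2), of p] by linarith
    qed
    then have bb: "bdd_below ((\<lambda>p. p w) ` C)" if "w \<in> S" for w
      using that by (intro bdd_belowI2[of _ "- q (- w)"]) auto
    have ule: "u w \<le> p w" if "p \<in> C" "w \<in> S" for p w
      unfolding u_def using that bb by (auto intro: cINF_lower)
    have uge: "c \<le> u w" if "w \<in> S" "\<And>p. p \<in> C \<Longrightarrow> c \<le> p w" for c w
      unfolding u_def using that False by (auto intro: cINF_greatest)
    have "u (v + w) \<le> u v + u w" if vw: "v \<in> S" "w \<in> S" for v w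
    proof -
      have *: "u (v + w) - p v \<le> p' w" if pp: "p \<in> C" "p' \<in> C" for p p'
      proof -
        obtain p'' where p'': "p'' \<in> C" "p'' v \<le> p v" "p'' w \<le> p' w"
          using Ccmp[OF pp] pp unfolding P_def by blast
        have "u (v + w) \<le> p'' (v + w)" using ule p'' SS vw by blast
        also have "\<dots> \<le> p'' v + p'' w" using p'' CA vw by (intro sub) (auto simp: A_def)
        finally show ?thesis using p'' by linarith
      qed
      have "u (v + w) - u w \<le> p v" if "p \<in> C" for p
      proof -
        have "u (v + w) - p v \<le> u w" using *[OF that] by (rule uge[OF vw(2)])
        then show ?thesis by simp
      qed
      then have "u (v + w) - u w \<le> u v" by (rule uge[OF vw(1)])
      then show ?thesis by simp
    qed
    moreover have "u (c *\<^sub>R w) \<le> c * u w" if "c > 0" "w \<in> S" for c w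
    proof -
      have "u (c *\<^sub>R w) / c \<le> u w"
      proof (rule uge[OF that(2)])
        fix p assume p: "p \<in> C"
        have "u (c *\<^sub>R w) \<le> p (c *\<^sub>R w)" using ule p SS that by blast
        also have "\<dots> = c * p w" using p CA that by (intro sublinear_on_scale[OF _ S]) (auto simp: A_def)
        finally show "u (c *\<^sub>R w) / c \<le> p w" using that by (simp add: field_simps)
      qed
      then show ?thesis using that by (simp add: field_simps)
    qed
    moreover have "u w \<le> q w" if "w \<in> S" for w
    proof -
      obtain p where "p \<in> C" using False by blast
      then have "u w \<le> p w" "p w \<le> q w" using ule that CA by (auto simp: A_def)
      then show ?thesis by simp
    qed
    moreover have "u w = 0" if "w \<notin> S" for w using that by (simp add: u_def)
    ultimately have "u \<in> A" by (simp add: A_def sublinear_on_def)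
    moreover have "P p u" if "p \<in> C" for p
      unfolding P_def
    proof
      fix w show "u w \<le> p w" using ule[OF that, of w] that CA by (cases "w \<in> S") (auto simp: u_def A_def)
    qed
    ultimately show ?thesis by blast
  qed
  from predicate_Zorn[OF po this] obtain p where p: "p \<in> A" and min: "\<And>a. a \<in> A \<Longrightarrow> P p a \<Longrightarrow> a = p"
    by blast
  have ps: "sublinear_on S p" and pq: "\<And>w. w \<in> S \<Longrightarrow> p w \<le> q w" and p0: "\<And>w. w \<notin> S \<Longrightarrow> p w = 0"
    using p by (auto simp: A_def)
  note pscale = sublinear_on_scale[OF ps S]
  have super: "p w + p v \<le> p (w + v)" if v: "v \<in> S" and w: "w \<in> S" for v w
  proof -
    \<comment> \<open>Lowering p in the direction v gives a sublinear functional below p, so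
      minimality forces \<open>u = p\<close>. The term \<open>s = 1\<close> of the infimum is then
      the missing superadditivity.\<close>
    define u where "u = (\<lambda>w. if w \<in> S then INF s\<in>{0..}. p (w + s *\<^sub>R v) - s * p v else 0)"
    have low: "- p (- w) \<le> p (w + s *\<^sub>R v) - s * p v" if "w \<in> S" "s \<ge> 0" for w s
    proof -
      have "p (- w + (w + s *\<^sub>R v)) \<le> p (- w) + p (w + s *\<^sub>R v)"
        using that v SS by (intro sub[OF ps]) auto
      then show ?thesis using pscale[OF v that(2)] by simp
    qed
    then have bb: "bdd_below ((\<lambda>s. p (w + s *\<^sub>R v) - s * p v) ` {0..})" if "w \<in> S" for w
      using that by (intro bdd_belowI2[of _ "- p (- w)"]) auto
    have ule: "u w \<le> p (w + s *\<^sub>R v) - s * p v" if "s \<ge> 0" "w \<in> S" for s w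
      unfolding u_def using that bb by (auto intro: cINF_lower)
    have uge: "c \<le> u w" if "w \<in> S" "\<And>s. s \<ge> 0 \<Longrightarrow> c \<le> p (w + s *\<^sub>R v) - s * p v" for c w
      unfolding u_def using that by (auto intro: cINF_greatest)
    have "u (w + w') \<le> u w + u w'" if ww: "w \<in> S" "w' \<in> S" for w w'
    proof -
      have *: "u (w + w') - (p (w + s *\<^sub>R v) - s * p v) \<le> p (w' + s' *\<^sub>R v) - s' * p v"
        if "s \<ge> 0" "s' \<ge> 0" for s s'
      proof -
        have "u (w + w') \<le> p (w + w' + (s + s') *\<^sub>R v) - (s + s') * p v"
          using that ww SS by (intro ule) auto
        also have "w + w' + (s + s') *\<^sub>R v = (w + s *\<^sub>R v) + (w' + s' *\<^sub>R v)"
          by (simp add: algebra_simps)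
        also have "p \<dots> \<le> p (w + s *\<^sub>R v) + p (w' + s' *\<^sub>R v)"
          using ww v SS by (intro sub[OF ps]) auto
        finally show ?thesis by (simp add: algebra_simps)
      qed
      have "u (w + w') - u w' \<le> p (w + s *\<^sub>R v) - s * p v" if "s \<ge> 0" for s
      proof -
        have "u (w + w') - (p (w + s *\<^sub>R v) - s * p v) \<le> u w'"
          using *[OF that] by (rule uge[OF ww(2)])
        then show ?thesis by simp
      qed
      then have "u (w + w') - u w' \<le> u w" by (rule uge[OF ww(1)])
      then show ?thesis by simp
    qed
    moreover have "u (c *\<^sub>R w) \<le> c * u w" if c: "c > 0" and w: "w \<in> S" for c w
    proof -
      have "u (c *\<^sub>R w) / c \<le> u w"
      proof (rule uge[OF w])
        fix s :: real assume s: "s \<ge> 0"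
        have "u (c *\<^sub>R w) \<le> p (c *\<^sub>R w + (c * s) *\<^sub>R v) - (c * s) * p v"
          using c s w SS by (intro ule) auto
        also have "c *\<^sub>R w + (c * s) *\<^sub>R v = c *\<^sub>R (w + s *\<^sub>R v)" by (simp add: algebra_simps)
        also have "p \<dots> = c * p (w + s *\<^sub>R v)" using c w v SS by (intro pscale) auto
        finally have "u (c *\<^sub>R w) \<le> c * (p (w + s *\<^sub>R v) - s * p v)" by (simp add: algebra_simps)
        then show "u (c *\<^sub>R w) / c \<le> p (w + s *\<^sub>R v) - s * p v" using c by (simp add: field_simps)
      qed
      then show ?thesis using c by (simp add: field_simps)
    qed
    moreover have up: "u w \<le> p w" for w
      using ule[of 0 w] p0 by (cases "w \<in> S") (auto simp: u_def)
    moreover have "u w = 0" if "w \<notin> S" for w using that by (simp add: u_def)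
    ultimately have "u \<in> A" using order_trans[OF up pq] by (simp add: A_def sublinear_on_def)
    then have "u = p" using min up by (simp add: P_def)
    then show ?thesis using ule[of 1 w] w by simp
  qed
  have add: "p (v + w) = p v + p w" if "v \<in> S" "w \<in> S" for v w
    using super[OF that(2,1)] sub[OF ps that] by simp
  have neg: "p (- w) = - p w" if "w \<in> S" for w
    using add[OF that, of "- w"] pscale[OF that, of 0] that SS by simp
  have "p (c *\<^sub>R w) = c * p w" if "w \<in> S" for c w
    using pscale[OF that, of c] pscale[of "- w" "- c"] neg[OF that] that SS by (cases "c \<ge> 0") auto
  with pq add show thesis by (rule that)
qed

section \<open>Maps from T to X as a real vector space\<close>

instantiation "fun" :: (type, real_vector) real_vector
begin

definition scaleR_fun :: "real \<Rightarrow> ('a \<Rightarrow> 'b) \<Rightarrow> 'a \<Rightarrow> 'b" where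
  "scaleR_fun c w = (\<lambda>t. c *\<^sub>R w t)"

instance
  by standard (auto simp: scaleR_fun_def plus_fun_def algebra_simps)

end

subsection \<open>Countably additive parts of finitely additive set functions\<close>

text \<open>
  A countable partition is encoded by its measurable labelling \<open>k\<close>; \<open>k'\<close> refines \<open>k\<close> iff \<open>k\<close> factors
  through \<open>k'\<close>. The sums of a charge over the pieces decrease under refinement, and their limit is
  its countably additive part. As a limit along a filter it depends linearly and monotonically on the
  charge.
\<close>

definition partitions :: "'t measure \<Rightarrow> ('t \<Rightarrow> nat) set" where
  "partitions M = measurable M (count_space UNIV)"

definition partition_sum :: "('t set \<Rightarrow> real) \<Rightarrow> 't set \<Rightarrow> ('t \<Rightarrow> nat) \<Rightarrow> real" where
  "partition_sum N A k = (\<Sum>i. N (A \<inter> k -` {i}))"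

definition partition_filter :: "'t measure \<Rightarrow> ('t \<Rightarrow> nat) filter" where
  "partition_filter M =
     (INF k\<in>partitions M. principal {k' \<in> partitions M. \<exists>h. \<forall>t\<in>space M. k t = h (k' t)})"

lemma const_in_partitions [simp]: "(\<lambda>_. n) \<in> partitions M"
  by (simp add: partitions_def)

lemma partitions_nonempty [simp]: "partitions M \<noteq> {}"
  using const_in_partitions[of 0 M] by blast

text \<open>Any two labellings have a common refinement, so the defining infimum runs over a
  directed family and can be tested on one labelling.\<close>

lemma eventually_partition_filter:
  "eventually P (partition_filter M) \<longleftrightarrow>
     (\<exists>k\<in>partitions M. \<forall>k'\<in>partitions M. (\<exists>h. \<forall>t\<in>space M. k t = h (k' t)) \<longrightarrow> P k')"
  unfolding partition_filter_def
proof (subst eventually_INF_base)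
  show "partitions M \<noteq> {}" by simp
next
  fix k1 k2 :: "'a \<Rightarrow> nat" assume k: "k1 \<in> partitions M" "k2 \<in> partitions M"
  \<comment> \<open>Paired labels describe the common refinement.\<close>
  let ?k = "\<lambda>t. prod_encode (k1 t, k2 t)"
  have "?k \<in> partitions M"
    using k unfolding partitions_def by measurable
  moreover have "\<exists>h. \<forall>t\<in>space M. k1 t = h (k' t)" "\<exists>h. \<forall>t\<in>space M. k2 t = h (k' t)"
    if "\<forall>t\<in>space M. ?k t = h (k' t)" for h k'
  proof -
    have "k1 t = fst (prod_decode (h (k' t)))" "k2 t = snd (prod_decode (h (k' t)))" if "t \<in> space M" for t
      using \<open>\<forall>t\<in>space M. ?k t = h (k' t)\<close> that by (metis prod_encode_inverse fst_conv snd_conv)+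
    then show "\<exists>h. \<forall>t\<in>space M. k1 t = h (k' t)" "\<exists>h. \<forall>t\<in>space M. k2 t = h (k' t)"
      by (intro exI[of _ "\<lambda>i. fst (prod_decode (h i))"] exI[of _ "\<lambda>i. snd (prod_decode (h i))"] ballI; simp)+
  qed
  ultimately show "\<exists>x\<in>partitions M. principal {k' \<in> partitions M. \<exists>h. \<forall>t\<in>space M. x t = h (k' t)}
     \<le> inf (principal {k' \<in> partitions M. \<exists>h. \<forall>t\<in>space M. k1 t = h (k' t)})
         (principal {k' \<in> partitions M. \<exists>h. \<forall>t\<in>space M. k2 t = h (k' t)})"
    unfolding inf_principal principal_le_iff by (intro bexI[of _ ?k]) blast+
qed (auto simp: eventually_principal)

lemma partition_filter_neq_bot [simp]: "partition_filter M \<noteq> bot"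
  unfolding trivial_limit_def eventually_partition_filter
proof clarify
  fix k assume "k \<in> partitions M" "\<forall>k'\<in>partitions M. (\<exists>h. \<forall>t\<in>space M. k t = h (k' t)) \<longrightarrow> False"
  moreover have "\<exists>h. \<forall>t\<in>space M. k t = h (k t)" by (rule exI[of _ "\<lambda>i. i"]) simp
  ultimately show False by blast
qed

lemma eventually_partitions: "\<forall>\<^sub>F k in partition_filter M. k \<in> partitions M"
  unfolding eventually_partition_filter using const_in_partitions by blast

lemma sets_partition_piece:
  assumes "A \<in> sets M" "k \<in> partitions M"
  shows "A \<inter> k -` J \<in> sets M"
proof -
  have "k -` J \<inter> space M \<in> sets M" using assms(2) by (simp add: partitions_def measurable_sets)
  then have "A \<inter> (k -` J \<inter> space M) \<in> sets M" using assms(1) by blast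
  also have "A \<inter> (k -` J \<inter> space M) = A \<inter> k -` J" using sets.sets_into_space[OF assms(1)] by blast
  finally show ?thesis .
qed

text \<open>Since the values are real, monotonicity bounds all of them by
  \<open>N (space M)\<close>.\<close>

locale charge =
  fixes M :: "'t measure" and N :: "'t set \<Rightarrow> real"
  assumes additive: "\<And>A B. A \<in> sets M \<Longrightarrow> B \<in> sets M \<Longrightarrow> A \<inter> B = {} \<Longrightarrow> N (A \<union> B) = N A + N B"
    and nonneg: "\<And>A. A \<in> sets M \<Longrightarrow> 0 \<le> N A"
begin

lemma empty [simp]: "N {} = 0"
  using additive[of "{}" "{}"] by simp

lemma mono: "A \<in> sets M \<Longrightarrow> B \<in> sets M \<Longrightarrow> A \<subseteq> B \<Longrightarrow> N A \<le> N B"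
  using additive[of A "B - A"] nonneg[of "B - A"] by (simp add: Un_absorb1)

lemma sum_pieces:
  assumes A: "A \<in> sets M" and k: "k \<in> partitions M" and "finite J"
  shows "(\<Sum>i\<in>J. N (A \<inter> k -` {i})) = N (A \<inter> k -` J)"
  using \<open>finite J\<close>
proof (induction J)
  case (insert i J)
  have "A \<inter> k -` insert i J = (A \<inter> k -` {i}) \<union> (A \<inter> k -` J)" by blast
  also have "N \<dots> = N (A \<inter> k -` {i}) + N (A \<inter> k -` J)"
    using insert.hyps by (intro additive sets_partition_piece A k) blast
  finally show ?case using insert by simp
qed simp

lemma summable_pieces:
  assumes A: "A \<in> sets M" and k: "k \<in> partitions M"
  shows "summable (\<lambda>i. N (A \<inter> k -` {i}))"
proof (rule summableI_nonneg_bounded)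
  show "0 \<le> N (A \<inter> k -` {i})" for i using nonneg sets_partition_piece A k by blast
  show "(\<Sum>i<n. N (A \<inter> k -` {i})) \<le> N A" for n
    by (subst sum_pieces[OF A k]) (auto intro!: mono sets_partition_piece A k)
qed

lemma partition_sum_nonneg:
  "A \<in> sets M \<Longrightarrow> k \<in> partitions M \<Longrightarrow> 0 \<le> partition_sum N A k"
  unfolding partition_sum_def by (intro suminf_nonneg summable_pieces nonneg sets_partition_piece)

text \<open>A charge dominates the sum of its values over countably many disjoint pieces, so
  refining only loses mass: the first n pieces of \<open>k'\<close> lie in the finitely many pieces
  of k with labels h(0), ..., h(n-1).\<close>

lemma partition_sum_refine:
  assumes A: "A \<in> sets M" and k: "k \<in> partitions M" and k': "k' \<in> partitions M"
    and h: "\<And>t. t \<in> space M \<Longrightarrow> k t = h (k' t)"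
  shows "partition_sum N A k' \<le> partition_sum N A k"
  unfolding partition_sum_def[of N A k']
proof (rule suminf_le_const[OF summable_pieces[OF A k']])
  fix n
  let ?B = "A \<inter> k' -` {..<n}"
  have B: "?B \<in> sets M" by (rule sets_partition_piece[OF A k'])
  have "?B \<inter> k -` (h ` {..<n}) = ?B"
    using h sets.sets_into_space[OF A] by auto
  then have "(\<Sum>i<n. N (A \<inter> k' -` {i})) = N (?B \<inter> k -` (h ` {..<n}))"
    using sum_pieces[OF A k', of "{..<n}"] by simp
  also have "\<dots> = (\<Sum>i\<in>h ` {..<n}. N (?B \<inter> k -` {i}))"
    by (rule sum_pieces[OF B k, symmetric]) simp
  also have "\<dots> \<le> (\<Sum>i\<in>h ` {..<n}. N (A \<inter> k -` {i}))"
    by (intro sum_mono mono sets_partition_piece A B k) auto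
  also have "\<dots> \<le> partition_sum N A k"
    unfolding partition_sum_def
    by (intro sum_le_suminf summable_pieces A k) (auto intro: nonneg sets_partition_piece A k)
  finally show "(\<Sum>i<n. N (A \<inter> k' -` {i})) \<le> partition_sum N A k" .
qed

text \<open>The countably additive part in the Yosida-Hewitt decomposition. As refinement decreases
  the sums, this infimum is also their limit along \<open>partition_filter M\<close>; bounds come
  from the infimum, additivity from the limit.\<close>

definition ctbl_part :: "'t set \<Rightarrow> real" where
  "ctbl_part A = (INF k\<in>partitions M. partition_sum N A k)"

lemma ctbl_part_le: "A \<in> sets M \<Longrightarrow> k \<in> partitions M \<Longrightarrow> ctbl_part A \<le> partition_sum N A k"
  unfolding ctbl_part_def
  by (intro cINF_lower bdd_belowI2[of _ 0] partition_sum_nonneg)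

lemma ctbl_part_nonneg: "A \<in> sets M \<Longrightarrow> 0 \<le> ctbl_part A"
  unfolding ctbl_part_def by (intro cINF_greatest partition_sum_nonneg partitions_nonempty)

lemma ctbl_part_le_charge: "A \<in> sets M \<Longrightarrow> ctbl_part A \<le> N A"
proof -
  assume A: "A \<in> sets M"
  have "partition_sum N A (\<lambda>_. 0) = N A"
    unfolding partition_sum_def by (subst suminf_finite[of "{0}"]) auto
  then show ?thesis using ctbl_part_le[OF A const_in_partitions[of 0 M]] by simp
qed

lemma tendsto_ctbl_part:
  assumes A: "A \<in> sets M"
  shows "(partition_sum N A \<longlongrightarrow> ctbl_part A) (partition_filter M)"
proof (rule order_tendstoI)
  fix a assume "a < ctbl_part A"
  then show "\<forall>\<^sub>F k in partition_filter M. a < partition_sum N A k"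
    by (intro eventually_mono[OF eventually_partitions[of M]]) (use ctbl_part_le[OF A] in force)
next
  fix a assume "ctbl_part A < a"
  then obtain k where k: "k \<in> partitions M" "partition_sum N A k < a"
    unfolding ctbl_part_def using const_in_partitions[of 0 M]
    by (subst (asm) cINF_less_iff) (auto intro!: bdd_belowI2[of _ 0] partition_sum_nonneg A)
  then show "\<forall>\<^sub>F k in partition_filter M. partition_sum N A k < a"
    unfolding eventually_partition_filter
  proof (intro bexI[OF _ k(1)] ballI impI)
    fix k' assume "k' \<in> partitions M" "\<exists>h. \<forall>t\<in>space M. k t = h (k' t)"
    then have "partition_sum N A k' \<le> partition_sum N A k"
      using partition_sum_refine[OF A k(1)] by blast
    then show "partition_sum N A k' < a" using k(2) by simp
  qed
qed

lemma ctbl_part_additive: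
  assumes AB: "A \<in> sets M" "B \<in> sets M" "A \<inter> B = {}"
  shows "ctbl_part (A \<union> B) = ctbl_part A + ctbl_part B"
proof (rule tendsto_unique[OF partition_filter_neq_bot tendsto_ctbl_part])
  have "partition_sum N (A \<union> B) k = partition_sum N A k + partition_sum N B k" if k: "k \<in> partitions M" for k
  proof -
    have "N ((A \<union> B) \<inter> k -` {i}) = N (A \<inter> k -` {i}) + N (B \<inter> k -` {i})" for i
      unfolding Int_Un_distrib2 using AB(3)
      by (intro additive sets_partition_piece AB(1,2) k) blast
    then show ?thesis
      unfolding partition_sum_def
      using suminf_add[OF summable_pieces[OF AB(1) k] summable_pieces[OF AB(2) k]] by simp
  qed
  then have "\<forall>\<^sub>F k in partition_filter M. partition_sum N A k + partition_sum N B k = partition_sum N (A \<union> B) k"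
    by (intro eventually_mono[OF eventually_partitions]) simp
  then show "(partition_sum N (A \<union> B) \<longlongrightarrow> ctbl_part A + ctbl_part B) (partition_filter M)"
    by (rule Lim_transform_eventually[OF tendsto_add[OF tendsto_ctbl_part[OF AB(1)] tendsto_ctbl_part[OF AB(2)]]])
qed (use AB in blast)

text \<open>Label t by the first n with t outside \<open>A n\<close>. Then \<open>A n\<close> meets
  only pieces with label at least n, so its sum for this one labelling is dominated by a tail of a
  convergent series.\<close>

lemma ctbl_part_continuous_empty:
  assumes A: "range A \<subseteq> sets M" "decseq A" "(\<Inter>i. A i) = {}"
  shows "(\<lambda>n. ctbl_part (A n)) \<longlonglongrightarrow> 0"
proof -
  have As: "A n \<in> sets M" for n using A(1) by blast
  define k where "k = (\<lambda>t. LEAST n. t \<notin> A n)"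
  have kM: "k \<in> partitions M"
    unfolding partitions_def k_def using As by measurable
  have k: "k t \<le> n \<longleftrightarrow> t \<notin> A n" for t n
  proof -
    have "\<exists>m. t \<notin> A m" using A(3) by blast
    then have "t \<notin> A (k t)" unfolding k_def by (rule LeastI_ex)
    moreover have "t \<notin> A n \<Longrightarrow> k t \<le> n" unfolding k_def by (rule Least_le)
    moreover have "A n \<subseteq> A (k t)" if "k t \<le> n" using A(2) that by (rule decseqD)
    ultimately show ?thesis by blast
  qed
  define a where "a = (\<lambda>i. N (space M \<inter> k -` {i}))"
  have sa: "summable a" unfolding a_def by (rule summable_pieces[OF _ kM]) simp
  have le: "ctbl_part (A n) \<le> suminf a - sum a {..<n}" for n
  proof -
    note s = summable_pieces[OF As[of n] kM]
    have "A n \<inter> k -` {i} = {}" if "i < n" for i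
    proof -
      have "t \<notin> A n" if "k t = i" for t
        using k[of t n] \<open>i < n\<close> that by simp
      then show ?thesis by blast
    qed
    then have z: "N (A n \<inter> k -` {i}) = 0" if "i < n" for i using that by simp
    have "ctbl_part (A n) \<le> partition_sum N (A n) k" by (rule ctbl_part_le[OF As kM])
    also have "\<dots> = (\<Sum>i. N (A n \<inter> k -` {i + n}))"
      unfolding partition_sum_def using suminf_split_initial_segment[OF s, of n] z by simp
    also have "\<dots> \<le> (\<Sum>i. a (i + n))"
    proof (intro suminf_le summable_ignore_initial_segment s sa)
      show "N (A n \<inter> k -` {i + n}) \<le> a (i + n)" for i
        unfolding a_def using sets.sets_into_space[OF As[of n]]
        by (intro mono sets_partition_piece kM As sets.top) blast
    qed
    also have "\<dots> = suminf a - sum a {..<n}" by (rule suminf_minus_initial_segment[OF sa])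
    finally show ?thesis .
  qed
  have "(\<lambda>n. suminf a - sum a {..<n}) \<longlonglongrightarrow> suminf a - suminf a"
    by (intro tendsto_diff tendsto_const summable_LIMSEQ sa)
  then have lim: "(\<lambda>n. suminf a - sum a {..<n}) \<longlonglongrightarrow> 0" by simp
  show ?thesis
    by (rule tendsto_sandwich[OF _ _ tendsto_const lim])
       (simp_all add: le ctbl_part_nonneg As)
qed

text \<open>Continuity at the empty set makes \<open>ctbl_part\<close> a finite measure, absolutely
  continuous because it lies below N, so Radon-Nikodym applies.\<close>

lemma ex_density_ctbl_part:
  assumes "sigma_finite_measure M" and null: "\<And>A. A \<in> null_sets M \<Longrightarrow> N A = 0"
  obtains g where "integrable M g" "\<And>t. 0 \<le> g t"
    "\<And>A. A \<in> sets M \<Longrightarrow> (partition_sum N A \<longlongrightarrow> (LINT t:A|M. g t)) (partition_filter M)"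
proof -
  interpret sigma_finite_measure M by fact
  define \<nu> where "\<nu> = measure_of (space M) (sets M) (\<lambda>A. ennreal (ctbl_part A))"
  have ca: "countably_additive (sets M) (\<lambda>A. ennreal (ctbl_part A))"
  proof (rule sets.empty_continuous_imp_countably_additive)
    show "positive (sets M) (\<lambda>A. ennreal (ctbl_part A))"
      using ctbl_part_le_charge[of "{}"] by (simp add: positive_def ennreal_neg)
    show "additive (sets M) (\<lambda>A. ennreal (ctbl_part A))"
      unfolding additive_def by (simp add: ctbl_part_additive ctbl_part_nonneg)
    show "(\<lambda>i. ennreal (ctbl_part (A i))) \<longlonglongrightarrow> 0"
      if "range A \<subseteq> sets M" "decseq A" "(\<Inter>i. A i) = {}" for A
      using tendsto_ennrealI[OF ctbl_part_continuous_empty[OF that]] by simp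
  qed simp
  have sets_\<nu> [simp]: "sets \<nu> = sets M" by (simp add: \<nu>_def)
  have em: "emeasure \<nu> A = ennreal (ctbl_part A)" if "A \<in> sets M" for A
    unfolding \<nu>_def using that
    by (intro emeasure_measure_of_sigma sets.sigma_algebra_axioms ca)
       (use ctbl_part_le_charge[of "{}"] in \<open>simp add: positive_def ennreal_neg\<close>)
  have "absolutely_continuous M \<nu>"
  proof -
    have "ctbl_part A \<le> 0" if "A \<in> null_sets M" for A
      using ctbl_part_le_charge[of A] null[OF that] that by auto
    then show ?thesis
      unfolding absolutely_continuous_def by (auto simp: null_sets_def em ennreal_neg)
  qed
  then obtain f where f [measurable]: "f \<in> borel_measurable M" and fd: "density M f = \<nu>"
    using Radon_Nikodym[of \<nu>] by auto
  have int: "(\<integral>\<^sup>+ t. f t * indicator A t \<partial>M) = ennreal (ctbl_part A)" if "A \<in> sets M" for A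
    using em[OF that] fd emeasure_density[OF f that] by simp
  have fin: "(\<integral>\<^sup>+ t. f t \<partial>M) = ennreal (ctbl_part (space M))"
    using int[OF sets.top] by (simp cong: nn_integral_cong)
  then have ae: "AE t in M. f t \<noteq> \<infinity>"
    by (intro nn_integral_PInf_AE f) simp
  \<comment> \<open>The density has finite integral, so it is finite almost everywhere and passing
    to real values changes it on a null set only.\<close>
  define g where "g = (\<lambda>t. enn2real (f t))"
  have [measurable]: "g \<in> borel_measurable M" unfolding g_def by measurable
  have gf: "AE t in M. ennreal (g t) = f t"
    using ae by (auto simp: g_def less_top)
  have g0: "0 \<le> g t" for t by (simp add: g_def)
  have "(\<integral>\<^sup>+ t. ennreal (g t) \<partial>M) = (\<integral>\<^sup>+ t. f t \<partial>M)"
    using gf by (intro nn_integral_cong_AE)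
  then have gi: "integrable M g"
    using fin g0 by (intro integrableI_nonneg) auto
  have "(LINT t:A|M. g t) = ctbl_part A" if A [measurable]: "A \<in> sets M" for A
  proof -
    have "(LINT t:A|M. g t) = enn2real (\<integral>\<^sup>+ t. ennreal (indicator A t * g t) \<partial>M)"
      unfolding set_lebesgue_integral_def using g0 by (simp add: integral_eq_nn_integral)
    also have "(\<integral>\<^sup>+ t. ennreal (indicator A t * g t) \<partial>M) = (\<integral>\<^sup>+ t. f t * indicator A t \<partial>M)"
      using gf by (intro nn_integral_cong_AE) (auto split: split_indicator)
    finally show ?thesis using int[OF A] ctbl_part_nonneg[OF A] by simp
  qed
  then show thesis using that[OF gi g0] tendsto_ctbl_part by simp
qed

end

section \<open>Densities of countably additive parts for set functions of either sign\<close>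

text \<open>Phrased as a limit so that it makes sense for signed N. Summability is included because
  a divergent series has an unspecified sum, for which linearity would fail.\<close>

definition has_density_part :: "'t measure \<Rightarrow> ('t set \<Rightarrow> real) \<Rightarrow> ('t \<Rightarrow> real) \<Rightarrow> bool" where
  "has_density_part M N g \<longleftrightarrow> integrable M g \<and>
     (\<forall>A\<in>sets M. (\<forall>k\<in>partitions M. summable (\<lambda>i. N (A \<inter> k -` {i}))) \<and>
       (partition_sum N A \<longlongrightarrow> (LINT t:A|M. g t)) (partition_filter M))"

lemma has_density_partD:
  assumes "has_density_part M N g"
  shows "integrable M g"
    and "A \<in> sets M \<Longrightarrow> k \<in> partitions M \<Longrightarrow> summable (\<lambda>i. N (A \<inter> k -` {i}))"
    and "A \<in> sets M \<Longrightarrow> (partition_sum N A \<longlongrightarrow> (LINT t:A|M. g t)) (partition_filter M)"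
  using assms unfolding has_density_part_def by auto

lemma set_integrable_of_integrable:
  fixes g :: "'t \<Rightarrow> real"
  shows "integrable M g \<Longrightarrow> A \<in> sets M \<Longrightarrow> set_integrable M A g"
  unfolding set_integrable_def by (rule integrable_mult_indicator)

lemma (in charge) ex_has_density_part:
  assumes "sigma_finite_measure M" and "\<And>A. A \<in> null_sets M \<Longrightarrow> N A = 0"
  obtains g where "has_density_part M N g" "\<And>t. 0 \<le> g t"
proof (rule ex_density_ctbl_part[OF assms])
  fix g assume "integrable M g" "\<And>t. 0 \<le> g t"
    "\<And>A. A \<in> sets M \<Longrightarrow> (partition_sum N A \<longlongrightarrow> (LINT t:A|M. g t)) (partition_filter M)"
  then show thesis
    by (intro that[of g]) (simp_all add: has_density_part_def summable_pieces)
qed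

text \<open>Countable additivity makes all partition sums equal to the integral itself.\<close>

lemma has_density_part_set_integral:
  assumes g: "integrable M g"
  shows "has_density_part M (\<lambda>A. LINT t:A|M. g t) g"
  unfolding has_density_part_def
proof (intro conjI ballI g)
  fix A assume A: "A \<in> sets M"
  have sums: "(\<lambda>i. LINT t:A \<inter> k -` {i}|M. g t) sums (LINT t:A|M. g t)" if k: "k \<in> partitions M" for k
  proof -
    \<comment> \<open>The charge of \<open>\<bar>g\<bar>\<close> supplies the summable majorant over
      the pieces.\<close>
    interpret abs: charge M "\<lambda>A. LINT t:A|M. \<bar>g t\<bar>"
    proof
      show "(LINT t:A \<union> B|M. \<bar>g t\<bar>) = (LINT t:A|M. \<bar>g t\<bar>) + (LINT t:B|M. \<bar>g t\<bar>)"
        if "A \<in> sets M" "B \<in> sets M" "A \<inter> B = {}" for A B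
        using that g by (intro set_integral_Un set_integrable_of_integrable) auto
      show "0 \<le> (LINT t:A|M. \<bar>g t\<bar>)" for A
        unfolding set_lebesgue_integral_def by (intro integral_nonneg_AE) auto
    qed
    have piece: "A \<inter> k -` {i} \<in> sets M" for i by (rule sets_partition_piece[OF A k])
    have "\<bar>LINT t:A \<inter> k -` {i}|M. g t\<bar> \<le> (LINT t:A \<inter> k -` {i}|M. \<bar>g t\<bar>)" for i
      using set_integral_norm_bound[OF set_integrable_of_integrable[OF g piece[of i]]] by simp
    then have "summable (\<lambda>i. LINT t:A \<inter> k -` {i}|M. g t)"
      using abs.summable_pieces[OF A k] by (intro summable_comparison_test[OF _ abs.summable_pieces[OF A k]]) auto
    moreover have U: "(\<Union>i. A \<inter> k -` {i}) = A" by auto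
    moreover have "(LINT t:(\<Union>i. A \<inter> k -` {i})|M. g t) = (\<Sum>i. LINT t:A \<inter> k -` {i}|M. g t)"
    proof (rule lebesgue_integral_countable_add[OF piece])
      show "A \<inter> k -` {i} \<inter> (A \<inter> k -` {j}) = {}" if "i \<noteq> j" for i j using that by auto
      show "set_integrable M (\<Union>i. A \<inter> k -` {i}) g"
        unfolding U by (rule set_integrable_of_integrable[OF g A])
    qed
    ultimately show ?thesis by (simp add: summable_sums)
  qed
  show "summable (\<lambda>i. LINT t:A \<inter> k -` {i}|M. g t)" if "k \<in> partitions M" for k
    using sums[OF that] by (rule sums_summable)
  have "\<forall>\<^sub>F k in partition_filter M. (LINT t:A|M. g t) = partition_sum (\<lambda>A. LINT t:A|M. g t) A k"
    using eventually_partitions[of M] sums sums_unique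
    by (auto elim!: eventually_mono simp: partition_sum_def)
  then show "(partition_sum (\<lambda>A. LINT t:A|M. g t) A \<longlongrightarrow> (LINT t:A|M. g t)) (partition_filter M)"
    by (rule Lim_transform_eventually[OF tendsto_const])
qed

lemma has_density_part_add:
  assumes "has_density_part M N g" "has_density_part M N' g'"
  shows "has_density_part M (\<lambda>A. N A + N' A) (\<lambda>t. g t + g' t)"
proof -
  have "(partition_sum (\<lambda>A. N A + N' A) A \<longlongrightarrow> (LINT t:A|M. g t + g' t)) (partition_filter M)" if A: "A \<in> sets M" for A
  proof -
    have "\<forall>\<^sub>F k in partition_filter M.
        partition_sum N A k + partition_sum N' A k = partition_sum (\<lambda>A. N A + N' A) A k"
      using eventually_partitions[of M] assms A
      by (auto elim!: eventually_mono simp: partition_sum_def has_density_part_def suminf_add)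
    moreover have "((\<lambda>k. partition_sum N A k + partition_sum N' A k) \<longlongrightarrow> (LINT t:A|M. g t + g' t)) (partition_filter M)"
      using assms A
      by (subst set_integral_add(2)) (auto simp: has_density_part_def set_integrable_of_integrable intro!: tendsto_add)
    ultimately show ?thesis by (rule Lim_transform_eventually[rotated])
  qed
  then show ?thesis using assms by (auto simp: has_density_part_def intro: summable_add)
qed

lemma has_density_part_cmult:
  assumes "has_density_part M N g"
  shows "has_density_part M (\<lambda>A. c * N A) (\<lambda>t. c * g t)"
proof -
  have "(partition_sum (\<lambda>A. c * N A) A \<longlongrightarrow> (LINT t:A|M. c * g t)) (partition_filter M)" if A: "A \<in> sets M" for A
  proof -
    have "\<forall>\<^sub>F k in partition_filter M. c * partition_sum N A k = partition_sum (\<lambda>A. c * N A) A k"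
      using eventually_partitions[of M] assms A
      by (auto elim!: eventually_mono simp: partition_sum_def has_density_part_def suminf_mult)
    moreover have "((\<lambda>k. c * partition_sum N A k) \<longlongrightarrow> (LINT t:A|M. c * g t)) (partition_filter M)"
      using assms A by (auto simp: has_density_part_def intro!: tendsto_mult_left)
    ultimately show ?thesis by (rule Lim_transform_eventually[rotated])
  qed
  then show ?thesis using assms by (auto simp: has_density_part_def intro: summable_mult)
qed

lemma has_density_part_cong:
  assumes "has_density_part M N g" "\<And>A. A \<in> sets M \<Longrightarrow> N A = N' A"
  shows "has_density_part M N' g"
proof -
  have "partition_sum N A k = partition_sum N' A k" if "A \<in> sets M" "k \<in> partitions M" for A k
    unfolding partition_sum_def using assms(2) sets_partition_piece[OF that] by simp
  then have "\<forall>\<^sub>F k in partition_filter M. partition_sum N A k = partition_sum N' A k" if "A \<in> sets M" for A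
    using eventually_partitions[of M] that by (auto elim!: eventually_mono)
  then have "(partition_sum N' A \<longlongrightarrow> (LINT t:A|M. g t)) (partition_filter M)" if "A \<in> sets M" for A
    using assms(1) that unfolding has_density_part_def by (blast intro: Lim_transform_eventually)
  moreover have "summable (\<lambda>i. N' (A \<inter> k -` {i}))" if "A \<in> sets M" "k \<in> partitions M" for A k
  proof -
    have "(\<lambda>i. N' (A \<inter> k -` {i})) = (\<lambda>i. N (A \<inter> k -` {i}))"
      using assms(2)[OF sets_partition_piece[OF that]] by simp
    then show ?thesis using assms(1) that by (simp add: has_density_part_def)
  qed
  ultimately show ?thesis
    using assms(1) by (simp add: has_density_part_def)
qed

lemma has_density_part_unique:
  assumes "has_density_part M N g" "has_density_part M N g'"
  shows "AE t in M. g t = g' t"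
proof (rule density_unique_real)
  show "(LINT t:A|M. g t) = (LINT t:A|M. g' t)" if "A \<in> sets M" for A
    by (rule tendsto_unique[OF partition_filter_neq_bot has_density_partD(3)[OF assms(1) that] has_density_partD(3)[OF assms(2) that]])
qed (use assms in \<open>auto simp: has_density_part_def\<close>)

text \<open>Test on the part of A where h < g: the integral of g - h over it is both nonnegative and
  nonpositive.\<close>

lemma set_integral_mono_imp_AE_le:
  fixes g h :: "'t \<Rightarrow> real"
  assumes g: "integrable M g" and h: "integrable M h" and A: "A \<in> sets M"
    and le: "\<And>B. B \<in> sets M \<Longrightarrow> B \<subseteq> A \<Longrightarrow> (LINT t:B|M. g t) \<le> (LINT t:B|M. h t)"
  shows "AE t in M. t \<in> A \<longrightarrow> g t \<le> h t"
proof -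
  have [measurable]: "g \<in> borel_measurable M" "h \<in> borel_measurable M" "A \<in> sets M" using g h A by auto
  define B where "B = {t\<in>space M. t \<in> A \<and> h t < g t}"
  have B [measurable]: "B \<in> sets M" unfolding B_def by measurable
  have BA: "B \<subseteq> A" by (auto simp: B_def)
  let ?d = "\<lambda>t. indicator B t * (g t - h t)"
  have nn: "AE t in M. 0 \<le> ?d t" by (auto simp: B_def split: split_indicator)
  have i: "integrable M ?d"
    using integrable_mult_indicator[OF B, of "\<lambda>t. g t - h t"] g h by simp
  have "integral\<^sup>L M ?d = (LINT t:B|M. g t) - (LINT t:B|M. h t)"
    using set_integral_diff(2)[OF set_integrable_of_integrable[OF g B] set_integrable_of_integrable[OF h B]]
    by (simp add: set_lebesgue_integral_def)
  then have "integral\<^sup>L M ?d = 0" using le[OF B BA] integral_nonneg_AE[OF nn] by simp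
  then have "AE t in M. ?d t = 0" using integral_nonneg_eq_0_iff_AE[OF i nn] by simp
  then show ?thesis
    using AE_space by eventually_elim (auto simp: B_def split: split_indicator_asm)
qed

lemma has_density_part_mono:
  assumes N: "has_density_part M N g" "has_density_part M N' g'" and A: "A \<in> sets M"
    and le: "\<And>B. B \<in> sets M \<Longrightarrow> B \<subseteq> A \<Longrightarrow> N B \<le> N' B"
  shows "AE t in M. t \<in> A \<longrightarrow> g t \<le> g' t"
proof (rule set_integral_mono_imp_AE_le[OF _ _ A])
  fix B assume B: "B \<in> sets M" "B \<subseteq> A"
  have "partition_sum N B k \<le> partition_sum N' B k" if k: "k \<in> partitions M" for k
    unfolding partition_sum_def
    by (intro suminf_le le sets_partition_piece B k)
       (use N B k in \<open>auto simp: has_density_part_def\<close>)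
  then have "\<forall>\<^sub>F k in partition_filter M. partition_sum N B k \<le> partition_sum N' B k"
    using eventually_partitions[of M] by (auto elim!: eventually_mono)
  then show "(LINT t:B|M. g t) \<le> (LINT t:B|M. g' t)"
    by (rule tendsto_le[OF partition_filter_neq_bot has_density_partD(3)[OF N(2) B(1)] has_density_partD(3)[OF N(1) B(1)]])
qed (use N in \<open>auto simp: has_density_part_def\<close>)

text \<open>The difference of the two sides is the mass of the purely finitely additive remainder.
  Its nonnegativity is used for \<open>excess\<close>, to bound the integral of \<ell>, and for
  \<open>slack\<close>, to obtain the normal.\<close>

lemma (in charge) has_density_part_le_charge:
  assumes "has_density_part M N g"
  shows "integral\<^sup>L M g \<le> N (space M)"
proof -
  have "(LINT t:space M|M. g t) = ctbl_part (space M)"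
    by (rule tendsto_unique[OF partition_filter_neq_bot has_density_partD(3)[OF assms sets.top] tendsto_ctbl_part[OF sets.top]])
  then show ?thesis
    using ctbl_part_le_charge[OF sets.top] assms
    by (simp add: has_density_part_def set_integral_space)
qed

subsection \<open>Extension of a subgradient to functions on \<open>T\<close>\<close>

text \<open>
  Bounding \<open>f\<^sub>t(x + w(t)) - f\<^sub>t(x)\<close> from above by an integrable \<open>g\<close>, instead of integrating it, avoids any
  measurability requirement on \<open>w\<close> and any case distinction on infinite values.
\<close>

locale integrand_subgradient = sigma_finite_measure M
  for M :: "'t measure" +
  fixes f :: "'t \<Rightarrow> 'a::real_vector \<Rightarrow> ereal" and x u0 :: 'a and fx :: "'t \<Rightarrow> real"
    and \<phi> :: "'a \<Rightarrow> real" and \<epsilon> :: real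
    and dominated :: "('t \<Rightarrow> 'a) \<Rightarrow> ('t \<Rightarrow> real) \<Rightarrow> bool"
  defines "dominated \<equiv> \<lambda>w g. integrable M g \<and> (AE t in M. f t (x + w t) \<le> ereal (fx t + g t))"
  assumes convex_f: "AE t in M. ereal_convex (f t)"
    and fx_integrable: "integrable M fx"
    and fx_eq: "AE t in M. f t x = ereal (fx t)"
    and linear_\<phi>: "linear \<phi>"
    and \<epsilon>_nonneg: "0 \<le> \<epsilon>"
    and \<phi>_le: "\<And>u g. dominated (\<lambda>_. u) g \<Longrightarrow> \<phi> u \<le> integral\<^sup>L M g + \<epsilon>"
    and absorbing: "\<And>u. \<exists>s>0. \<exists>g. dominated (\<lambda>_. u0 + s *\<^sub>R u) g \<and> dominated (\<lambda>_. u0 - s *\<^sub>R u) g"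
begin

lemma dominated_integrable: "dominated w g \<Longrightarrow> integrable M g"
  by (simp add: dominated_def)

lemma dominated_convex:
  assumes d: "dominated w g" "dominated w' g'" and c: "0 \<le> c" "c \<le> 1"
  shows "dominated (\<lambda>t. (1 - c) *\<^sub>R w t + c *\<^sub>R w' t) (\<lambda>t. (1 - c) * g t + c * g' t)"
proof -
  have "AE t in M. f t (x + w t) \<le> ereal (fx t + g t)" "AE t in M. f t (x + w' t) \<le> ereal (fx t + g' t)"
    using d by (auto simp: dominated_def)
  with convex_f have "AE t in M. f t (x + ((1 - c) *\<^sub>R w t + c *\<^sub>R w' t)) \<le> ereal (fx t + ((1 - c) * g t + c * g' t))"
  proof eventually_elim
    case (elim t)
    have "x + ((1 - c) *\<^sub>R w t + c *\<^sub>R w' t) = (1 - c) *\<^sub>R (x + w t) + c *\<^sub>R (x + w' t)"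
      by (simp add: algebra_simps)
    then have "f t (x + ((1 - c) *\<^sub>R w t + c *\<^sub>R w' t)) \<le> ereal (1 - c) * f t (x + w t) + ereal c * f t (x + w' t)"
      using elim(1) c unfolding ereal_convex_def by auto
    also have "\<dots> \<le> ereal (1 - c) * ereal (fx t + g t) + ereal c * ereal (fx t + g' t)"
      using elim(2,3) c by (intro add_mono ereal_mult_left_mono) auto
    also have "\<dots> = ereal (fx t + ((1 - c) * g t + c * g' t))" by (simp add: algebra_simps)
    finally show ?case .
  qed
  then show ?thesis using d by (auto simp: dominated_def)
qed

lemma dominated_cong_AE:
  assumes "dominated w g" "AE t in M. w t = w' t"
  shows "dominated w' g"
proof -
  have "AE t in M. f t (x + w t) \<le> ereal (fx t + g t)" using assms by (simp add: dominated_def)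
  with assms(2) have "AE t in M. f t (x + w' t) \<le> ereal (fx t + g t)" by eventually_elim simp
  then show ?thesis using assms by (simp add: dominated_def)
qed

lemma dominated_zero: "dominated (\<lambda>_. 0) (\<lambda>_. 0)"
  using fx_eq by (auto simp: dominated_def)

text \<open>This is the decomposability that allows the argument to be localised to measurable
  subsets of T.\<close>

lemma dominated_glue:
  assumes d: "dominated w g" "dominated w' g'" and A: "A \<in> sets M"
  shows "dominated (\<lambda>t. if t \<in> A then w t else w' t) (\<lambda>t. if t \<in> A then g t else g' t)"
proof -
  have "AE t in M. f t (x + w t) \<le> ereal (fx t + g t)" "AE t in M. f t (x + w' t) \<le> ereal (fx t + g' t)"
    using d by (auto simp: dominated_def)
  then have "AE t in M. f t (x + (if t \<in> A then w t else w' t)) \<le> ereal (fx t + (if t \<in> A then g t else g' t))"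
    by eventually_elim simp
  moreover have "integrable M (\<lambda>t. if t \<in> A then g t else g' t)"
  proof -
    have "integrable M (\<lambda>t. indicator A t *\<^sub>R g t + indicator (space M - A) t *\<^sub>R g' t)"
      using d A by (intro Bochner_Integration.integrable_add integrable_mult_indicator) (auto simp: dominated_def)
    then show ?thesis
      by (rule Bochner_Integration.integrable_cong[THEN iffD1, rotated -1]) (auto split: split_indicator)
  qed
  ultimately show ?thesis by (simp add: dominated_def)
qed

section \<open>Localisation and the space of test functions\<close>

text \<open>Polymorphic, to cut maps into X and their real majorants alike.\<close>

definition cut :: "'t set \<Rightarrow> ('t \<Rightarrow> 'b::zero) \<Rightarrow> 't \<Rightarrow> 'b" where
  "cut A w = (\<lambda>t. if t \<in> A then w t else 0)"

lemma dominated_cut: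
  "dominated w g \<Longrightarrow> A \<in> sets M \<Longrightarrow> dominated (cut A w) (cut A g)"
  unfolding cut_def by (rule dominated_glue[OF _ dominated_zero])

text \<open>Directions along which the integrand has an integrable majorant on both sides of
  \<open>u0\<close>. Two-sidedness makes them a subspace, and it provides gauge values for both w
  and -w.\<close>

definition test_functions :: "('t \<Rightarrow> 'a) set" where
  "test_functions = {w. \<exists>s>0. \<exists>g. dominated (\<lambda>t. u0 + s *\<^sub>R w t) g \<and> dominated (\<lambda>t. u0 - s *\<^sub>R w t) g}"

lemma const_test_function: "(\<lambda>_. u) \<in> test_functions"
  using absorbing unfolding test_functions_def by blast

lemma obtain_dominated_u0: obtains g where "dominated (\<lambda>_. u0) g"
  using absorbing[of 0] by auto

text \<open>Shrinking \<open>s\<close> is harmless: \<open>u0 + s' w\<close> lies on the segment between \<open>u0 - s w\<close> and \<open>u0 + s w\<close>.\<close>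

lemma dominated_shrink:
  assumes d: "dominated (\<lambda>t. u0 + s *\<^sub>R w t) g" "dominated (\<lambda>t. u0 - s *\<^sub>R w t) g"
    and s: "\<bar>s'\<bar> \<le> s" "s > 0"
  shows "dominated (\<lambda>t. u0 + s' *\<^sub>R w t) g"
proof -
  \<comment> \<open>The weight with \<open>(1 - c) * s - c * s = s'\<close>.\<close>
  define c where "c = (1 - s' / s) / 2"
  have c: "0 \<le> c" "c \<le> 1" using s unfolding c_def by (auto simp: field_simps abs_le_iff)
  have cs: "(1 - c) * s - c * s = s'"
  proof -
    have "2 * c = 1 - s' / s" by (simp add: c_def)
    then have "(1 - c) - c = s' / s" by simp
    then show ?thesis using s(2) by (metis left_diff_distrib nonzero_eq_divide_eq less_irrefl)
  qed
  have "(1 - c) *\<^sub>R (u0 + s *\<^sub>R w t) + c *\<^sub>R (u0 - s *\<^sub>R w t) = u0 + ((1 - c) * s - c * s) *\<^sub>R w t" for t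
  proof -
    have "(c * (s * 2)) *\<^sub>R w t = (c * s) *\<^sub>R w t + (c * s) *\<^sub>R w t"
      unfolding scaleR_left_distrib[symmetric] by simp
    then show ?thesis by (simp add: algebra_simps)
  qed
  then have "(1 - c) *\<^sub>R (u0 + s *\<^sub>R w t) + c *\<^sub>R (u0 - s *\<^sub>R w t) = u0 + s' *\<^sub>R w t" for t
    unfolding cs .
  moreover have "(1 - c) * g t + c * g t = g t" for t by (simp add: algebra_simps)
  ultimately show ?thesis using dominated_convex[OF d c] by simp
qed

lemma subspace_test_functions: "subspace test_functions"
proof (rule subspaceI)
  show "0 \<in> test_functions" using const_test_function[of 0] by (simp add: zero_fun_def)
next
  fix v w :: "'t \<Rightarrow> 'a" assume "v \<in> test_functions" "w \<in> test_functions"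
  then obtain s g r h where s: "s > 0" "dominated (\<lambda>t. u0 + s *\<^sub>R v t) g" "dominated (\<lambda>t. u0 - s *\<^sub>R v t) g"
    and r: "r > 0" "dominated (\<lambda>t. u0 + r *\<^sub>R w t) h" "dominated (\<lambda>t. u0 - r *\<^sub>R w t) h"
    unfolding test_functions_def by blast
  \<comment> \<open>\<open>u0 + c (v + w)\<close> is the midpoint of \<open>u0 + 2 c v\<close> and
    \<open>u0 + 2 c w\<close>, so \<open>2 c\<close> has to stay below s and r.\<close>
  define c where "c = min s r / 2"
  have c: "c > 0" "\<bar>2 * c\<bar> \<le> s" "\<bar>2 * c\<bar> \<le> r" "\<bar>- (2 * c)\<bar> \<le> s" "\<bar>- (2 * c)\<bar> \<le> r"
    using s r by (auto simp: c_def)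
  define k where "k = (\<lambda>t. (1 - 1/2) * g t + 1/2 * h t)"
  have half: "(1 - 1/2) *\<^sub>R (u0 + a *\<^sub>R v t) + (1/2) *\<^sub>R (u0 + a *\<^sub>R w t) = u0 + (a / 2) *\<^sub>R (v + w) t" for a t
    by (simp add: algebra_simps flip: scaleR_add_left)
  have "dominated (\<lambda>t. u0 + c *\<^sub>R (v + w) t) k"
    using dominated_convex[OF dominated_shrink[OF s(2,3) c(2) s(1)] dominated_shrink[OF r(2,3) c(3) r(1)], of "1/2"]
    unfolding half k_def by simp
  moreover have "dominated (\<lambda>t. u0 - c *\<^sub>R (v + w) t) k"
    using dominated_convex[OF dominated_shrink[OF s(2,3) c(4) s(1)] dominated_shrink[OF r(2,3) c(5) r(1)], of "1/2"]
    unfolding half k_def by simp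
  ultimately show "v + w \<in> test_functions" using c(1) unfolding test_functions_def by blast
next
  fix c :: real and w :: "'t \<Rightarrow> 'a" assume "w \<in> test_functions"
  then obtain s g where s: "s > 0" "dominated (\<lambda>t. u0 + s *\<^sub>R w t) g" "dominated (\<lambda>t. u0 - s *\<^sub>R w t) g"
    unfolding test_functions_def by blast
  \<comment> \<open>The added 1 keeps the denominator positive for c = 0 and still leaves
    \<open>\<bar>r * c\<bar> \<le> s\<close>.\<close>
  define r where "r = s / (\<bar>c\<bar> + 1)"
  have r: "r > 0" using s by (simp add: r_def add_nonneg_pos)
  have "\<bar>r * c\<bar> \<le> s"
    using s by (auto simp: r_def abs_mult field_simps)
  then have "dominated (\<lambda>t. u0 + (r * c) *\<^sub>R w t) g" "dominated (\<lambda>t. u0 - (r * c) *\<^sub>R w t) g"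
    using dominated_shrink[OF s(2,3) _ s(1), of "r * c"] dominated_shrink[OF s(2,3) _ s(1), of "- (r * c)"]
    by (simp_all only: abs_minus_cancel scaleR_minus_left add_uminus_conv_diff)
  then show "c *\<^sub>R w \<in> test_functions"
    using r unfolding test_functions_def scaleR_fun_def by auto
qed

lemma cut_test_function:
  assumes "w \<in> test_functions" "A \<in> sets M"
  shows "cut A w \<in> test_functions"
proof -
  obtain s g where s: "s > 0" "dominated (\<lambda>t. u0 + s *\<^sub>R w t) g" "dominated (\<lambda>t. u0 - s *\<^sub>R w t) g"
    using assms unfolding test_functions_def by blast
  obtain g0 where g0: "dominated (\<lambda>_. u0) g0" by (rule obtain_dominated_u0)
  define k where "k = (\<lambda>t. if t \<in> A then g t else g0 t)"
  have "(\<lambda>t. if t \<in> A then u0 + s *\<^sub>R w t else u0) = (\<lambda>t. u0 + s *\<^sub>R cut A w t)"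
    "(\<lambda>t. if t \<in> A then u0 - s *\<^sub>R w t else u0) = (\<lambda>t. u0 - s *\<^sub>R cut A w t)"
    by (auto simp: cut_def)
  then have "dominated (\<lambda>t. u0 + s *\<^sub>R cut A w t) k" "dominated (\<lambda>t. u0 - s *\<^sub>R cut A w t) k"
    using dominated_glue[OF s(2) g0 assms(2)] dominated_glue[OF s(3) g0 assms(2)] by (simp_all add: k_def)
  then show ?thesis using s(1) unfolding test_functions_def by blast
qed

text \<open>
  The infimum of these values is the sublinear bound imposed on \<open>\<Phi>\<close>: the scaling \<open>s\<close> makes
  the bound homogeneous, and the free constant \<open>u\<close>, subtracted through \<open>\<phi>\<close>, both forces \<open>\<Phi> = \<phi>\<close> on constants
  and makes the infimum range over a nonempty set, because the point \<open>u0\<close> of finiteness need not be \<open>0\<close>.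
\<close>

definition gauge_values :: "('t \<Rightarrow> 'a) \<Rightarrow> real set" where
  "gauge_values w = {(integral\<^sup>L M g + \<epsilon>) / s - \<phi> u | s u g. s > 0 \<and> dominated (\<lambda>t. s *\<^sub>R (w t + u)) g}"

lemma gauge_values_nonempty:
  assumes "w \<in> test_functions"
  shows "gauge_values w \<noteq> {}"
proof -
  obtain s g where s: "s > 0" "dominated (\<lambda>t. u0 + s *\<^sub>R w t) g"
    using assms unfolding test_functions_def by blast
  have "u0 + s *\<^sub>R w t = s *\<^sub>R (w t + inverse s *\<^sub>R u0)" for t
    using s by (simp add: algebra_simps)
  then have "dominated (\<lambda>t. s *\<^sub>R (w t + inverse s *\<^sub>R u0)) g" using s(2) by simp
  then show ?thesis using s(1) unfolding gauge_values_def by blast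
qed

text \<open>Convex weights \<open>r / (s + r)\<close> and \<open>s / (s + r)\<close> bring the
  scales s and r to a common \<open>q\<close> with 1/q = 1/s + 1/r. The values then add exactly, the
  contributions of \<epsilon> included.\<close>

lemma gauge_values_add:
  assumes "a \<in> gauge_values v" "b \<in> gauge_values w"
  shows "a + b \<in> gauge_values (v + w)"
proof -
  obtain s u g where s: "s > 0" "dominated (\<lambda>t. s *\<^sub>R (v t + u)) g" "a = (integral\<^sup>L M g + \<epsilon>) / s - \<phi> u"
    using assms unfolding gauge_values_def by blast
  obtain r z h where r: "r > 0" "dominated (\<lambda>t. r *\<^sub>R (w t + z)) h" "b = (integral\<^sup>L M h + \<epsilon>) / r - \<phi> z"
    using assms unfolding gauge_values_def by blast
  define c where "c = s / (s + r)"
  have c: "0 \<le> c" "c \<le> 1" "1 - c = r / (s + r)" using s r by (auto simp: c_def field_simps)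
  define q where "q = s * r / (s + r)"
  have q: "q > 0" using s r by (simp add: q_def)
  have qs: "(1 - c) * s = q" "c * r = q" using c s r by (auto simp: c_def q_def field_simps)
  define k where "k = (\<lambda>t. (1 - c) * g t + c * h t)"
  have "(1 - c) *\<^sub>R (s *\<^sub>R (v t + u)) + c *\<^sub>R (r *\<^sub>R (w t + z)) = q *\<^sub>R ((v + w) t + (u + z))" for t
    unfolding scaleR_scaleR qs by (simp add: algebra_simps)
  then have "dominated (\<lambda>t. q *\<^sub>R ((v + w) t + (u + z))) k"
    using dominated_convex[OF s(2) r(2) c(1,2)] by (simp add: k_def)
  moreover have "a + b = (integral\<^sup>L M k + \<epsilon>) / q - \<phi> (u + z)"
  proof -
    have "integral\<^sup>L M k + \<epsilon> = (1 - c) * (integral\<^sup>L M g + \<epsilon>) + c * (integral\<^sup>L M h + \<epsilon>)"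
      unfolding k_def using dominated_integrable[OF s(2)] dominated_integrable[OF r(2)]
      by (simp add: algebra_simps)
    also have "(1 - c) * A = q * (A / s)" for A unfolding qs(1)[symmetric] using s(1) by simp
    also have "c * A = q * (A / r)" for A unfolding qs(2)[symmetric] using r(1) by simp
    finally have *: "integral\<^sup>L M k + \<epsilon> = q * ((integral\<^sup>L M g + \<epsilon>) / s) + q * ((integral\<^sup>L M h + \<epsilon>) / r)" .
    have "(integral\<^sup>L M k + \<epsilon>) / q = (integral\<^sup>L M g + \<epsilon>) / s + (integral\<^sup>L M h + \<epsilon>) / r"
      unfolding * add_divide_distrib[of _ _ q] using q by simp
    then show ?thesis using s(3) r(3) linear_\<phi> by (simp add: linear_add)
  qed
  ultimately show ?thesis using q unfolding gauge_values_def by blast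
qed

lemma gauge_values_scale:
  assumes "a \<in> gauge_values w" "c > 0"
  shows "c * a \<in> gauge_values (c *\<^sub>R w)"
proof -
  obtain s u g where s: "s > 0" "dominated (\<lambda>t. s *\<^sub>R (w t + u)) g" "a = (integral\<^sup>L M g + \<epsilon>) / s - \<phi> u"
    using assms unfolding gauge_values_def by blast
  have "(s / c) *\<^sub>R ((c *\<^sub>R w) t + c *\<^sub>R u) = s *\<^sub>R (w t + u)" for t
    using assms(2) by (simp add: scaleR_fun_def algebra_simps)
  moreover have "c * a = (integral\<^sup>L M g + \<epsilon>) / (s / c) - \<phi> (c *\<^sub>R u)"
    using s(3) assms(2) linear_\<phi> by (simp add: linear_scale right_diff_distrib mult.commute)
  moreover have "s / c > 0" using s(1) assms(2) by simp
  ultimately show ?thesis using s(2) unfolding gauge_values_def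
    by (intro CollectI) (rule exI[of _ "s / c"], rule exI[of _ "c *\<^sub>R u"], rule exI[of _ g], simp)
qed

text \<open>This is the subgradient inequality in the direction s u, divided by s; every lower bound
  on gauge values comes from it.\<close>

lemma gauge_values_zero: "a \<in> gauge_values 0 \<Longrightarrow> 0 \<le> a"
proof -
  assume "a \<in> gauge_values 0"
  then obtain s u g where s: "s > 0" "dominated (\<lambda>t. s *\<^sub>R u) g" "a = (integral\<^sup>L M g + \<epsilon>) / s - \<phi> u"
    unfolding gauge_values_def by auto
  have "s * \<phi> u \<le> integral\<^sup>L M g + \<epsilon>" using \<phi>_le[OF s(2)] linear_\<phi> by (simp add: linear_scale)
  then have "\<phi> u \<le> (integral\<^sup>L M g + \<epsilon>) / s" using s(1) by (simp add: pos_le_divide_eq mult.commute)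
  then show "0 \<le> a" using s(3) by simp
qed

text \<open>A value b for -w gives the lower bound -b, since a + b is a value for 0.\<close>

lemma bdd_below_gauge_values:
  assumes "w \<in> test_functions"
  shows "bdd_below (gauge_values w)"
proof -
  have "- w \<in> test_functions" using assms subspace_test_functions by (rule subspace_neg[rotated])
  then obtain b where b: "b \<in> gauge_values (- w)" using gauge_values_nonempty by blast
  have "- b \<le> a" if "a \<in> gauge_values w" for a
    using gauge_values_zero[of "a + b"] gauge_values_add[OF that b] by simp
  then show ?thesis by (rule bdd_belowI)
qed

lemma sublinear_gauge: "sublinear_on test_functions (\<lambda>w. Inf (gauge_values w))"
  unfolding sublinear_on_def
proof (intro conjI ballI allI impI)
  fix v w assume vw: "v \<in> test_functions" "w \<in> test_functions"
  have vw': "v + w \<in> test_functions" using subspace_add[OF subspace_test_functions vw] .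
  have le: "Inf (gauge_values (v + w)) \<le> a + b" if "a \<in> gauge_values v" "b \<in> gauge_values w" for a b
    using cInf_lower[OF gauge_values_add[OF that] bdd_below_gauge_values[OF vw']] .
  have "Inf (gauge_values (v + w)) - Inf (gauge_values w) \<le> a" if a: "a \<in> gauge_values v" for a
  proof -
    have "Inf (gauge_values (v + w)) - a \<le> Inf (gauge_values w)"
      using le[OF a] by (intro cInf_greatest gauge_values_nonempty vw) force
    then show ?thesis by simp
  qed
  then have "Inf (gauge_values (v + w)) - Inf (gauge_values w) \<le> Inf (gauge_values v)"
    by (intro cInf_greatest gauge_values_nonempty vw)
  then show "Inf (gauge_values (v + w)) \<le> Inf (gauge_values v) + Inf (gauge_values w)" by simp
next
  fix c :: real and w assume c: "0 < c" and w: "w \<in> test_functions"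
  have cw: "c *\<^sub>R w \<in> test_functions" using subspace_scale[OF subspace_test_functions w] .
  have "Inf (gauge_values (c *\<^sub>R w)) / c \<le> Inf (gauge_values w)"
  proof (rule cInf_greatest[OF gauge_values_nonempty[OF w]])
    fix a assume "a \<in> gauge_values w"
    then have "Inf (gauge_values (c *\<^sub>R w)) \<le> c * a"
      by (intro cInf_lower gauge_values_scale bdd_below_gauge_values cw c)
    then show "Inf (gauge_values (c *\<^sub>R w)) / c \<le> a" using c by (simp add: field_simps)
  qed
  then show "Inf (gauge_values (c *\<^sub>R w)) \<le> c * Inf (gauge_values w)" using c by (simp add: field_simps)
qed

text \<open>For a constant u the shift -u makes the dominated map zero, with value \<epsilon>/s +
  \<phi>(u). Large s gives \<Phi> \<le> \<phi> on constants, and linearity gives equality.\<close>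

lemma ex_extension:
  obtains \<Phi> where "\<And>u. \<Phi> (\<lambda>_. u) = \<phi> u"
    and "\<And>w g. w \<in> test_functions \<Longrightarrow> dominated w g \<Longrightarrow> \<Phi> w \<le> integral\<^sup>L M g + \<epsilon>"
    and "\<And>v w. v \<in> test_functions \<Longrightarrow> w \<in> test_functions \<Longrightarrow> \<Phi> (v + w) = \<Phi> v + \<Phi> w"
    and "\<And>c w. w \<in> test_functions \<Longrightarrow> \<Phi> (c *\<^sub>R w) = c * \<Phi> w"
proof -
  obtain \<Phi> where le: "\<And>w. w \<in> test_functions \<Longrightarrow> \<Phi> w \<le> Inf (gauge_values w)"
    and add: "\<And>v w. v \<in> test_functions \<Longrightarrow> w \<in> test_functions \<Longrightarrow> \<Phi> (v + w) = \<Phi> v + \<Phi> w"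
    and scale: "\<And>c w. w \<in> test_functions \<Longrightarrow> \<Phi> (c *\<^sub>R w) = c * \<Phi> w"
    using hahn_banach_sublinear_on[OF sublinear_gauge subspace_test_functions] by metis
  have le': "\<Phi> w \<le> a" if "w \<in> test_functions" "a \<in> gauge_values w" for w a
    using le[OF that(1)] cInf_lower[OF that(2) bdd_below_gauge_values[OF that(1)]] by simp
  have "\<Phi> (\<lambda>_. u) \<le> \<phi> u" for u
  proof (rule field_le_epsilon)
    fix e :: real assume e: "e > 0"
    \<comment> \<open>Large enough for \<epsilon>/s \<le> e; the summand 1 keeps s positive when
      \<epsilon> = 0.\<close>
    define s where "s = (\<epsilon> + 1) / e"
    have s: "s > 0" using e \<epsilon>_nonneg by (simp add: s_def add_nonneg_pos)
    have "(integral\<^sup>L M (\<lambda>_::'t. 0::real) + \<epsilon>) / s - \<phi> (- u) \<in> gauge_values (\<lambda>_. u)"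
      unfolding gauge_values_def using s dominated_zero
      by (intro CollectI) (rule exI[of _ s], rule exI[of _ "- u"], rule exI[of _ "\<lambda>_. 0"], simp)
    then have "\<Phi> (\<lambda>_. u) \<le> \<epsilon> / s - \<phi> (- u)" using le'[OF const_test_function] by fastforce
    also have "\<epsilon> / s \<le> e" using e \<epsilon>_nonneg by (simp add: s_def field_simps)
    finally show "\<Phi> (\<lambda>_. u) \<le> \<phi> u + e" using linear_\<phi> by (simp add: linear_neg)
  qed
  note 1 = this
  have "\<Phi> (\<lambda>_. u) = \<phi> u" for u
  proof -
    have "(-1) *\<^sub>R (\<lambda>_::'t. u) = (\<lambda>_. - u)" by (simp add: scaleR_fun_def)
    then have "\<Phi> (\<lambda>_. - u) = - \<Phi> (\<lambda>_. u)" using scale[OF const_test_function[of u], of "-1"] by simp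
    then show ?thesis using 1[of u] 1[of "- u"] linear_\<phi> by (simp add: linear_neg)
  qed
  moreover have "\<Phi> w \<le> integral\<^sup>L M g + \<epsilon>" if "w \<in> test_functions" "dominated w g" for w g
  proof -
    have "(integral\<^sup>L M g + \<epsilon>) / 1 - \<phi> 0 \<in> gauge_values w"
      unfolding gauge_values_def
      by (rule CollectI, rule exI[of _ 1], rule exI[of _ 0], rule exI[of _ g]) (simp add: that(2))
    then show ?thesis using le'[OF that(1)] linear_\<phi> by (fastforce simp: linear_0)
  qed
  ultimately show thesis using that add scale by blast
qed

end

section \<open>Set functions generated by the extended functional\<close>

text \<open>A second locale, because the conditions on \<Phi> speak of
  \<open>test_functions\<close>. Inside it \<open>'a\<close> is the type of points of T and
  \<open>'b\<close> that of vectors of X.\<close>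

locale integrand_extension = integrand_subgradient +
  fixes \<Phi>
  assumes \<Phi>_const: "\<And>u. \<Phi> (\<lambda>_. u) = \<phi> u"
    and \<Phi>_le: "\<And>w g. w \<in> test_functions \<Longrightarrow> dominated w g \<Longrightarrow> \<Phi> w \<le> integral\<^sup>L M g + \<epsilon>"
    and \<Phi>_add: "\<And>v w. v \<in> test_functions \<Longrightarrow> w \<in> test_functions \<Longrightarrow> \<Phi> (v + w) = \<Phi> v + \<Phi> w"
    and \<Phi>_scale: "\<And>c w. w \<in> test_functions \<Longrightarrow> \<Phi> (c *\<^sub>R w) = c * \<Phi> w"
begin

text \<open>The set function \<open>\<lambda>\<^sub>u\<close> of the overview.\<close>

definition slice :: "'b \<Rightarrow> 'a set \<Rightarrow> real" where
  "slice u A = \<Phi> (cut A (\<lambda>_. u))"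

text \<open>Their supremum \<open>excess\<close> is the set function E. The majorant vanishes off A
  as well, so that pairs for disjoint sets can be pasted and their values summed.\<close>

definition excess_values :: "'a set \<Rightarrow> real set" where
  "excess_values A = {\<Phi> w - integral\<^sup>L M g | w g. w \<in> test_functions \<and> dominated w g \<and> cut A w = w \<and> cut A g = g}"

definition excess :: "'a set \<Rightarrow> real" where
  "excess A = Sup (excess_values A)"

lemma cut_const_test_function: "A \<in> sets M \<Longrightarrow> cut A (\<lambda>_. u) \<in> test_functions"
  by (rule cut_test_function[OF const_test_function])

lemma \<Phi>_zero: "\<Phi> 0 = 0"
  using \<Phi>_scale[OF subspace_0[OF subspace_test_functions], of 0] by simp

lemma excess_valuesI:
  "w \<in> test_functions \<Longrightarrow> dominated w g \<Longrightarrow> cut A w = w \<Longrightarrow> cut A g = g \<Longrightarrow>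
    \<Phi> w - integral\<^sup>L M g \<in> excess_values A"
  unfolding excess_values_def by blast

lemma excess_valuesE:
  assumes "a \<in> excess_values A"
  obtains w g where "w \<in> test_functions" "dominated w g" "cut A w = w" "cut A g = g"
    "a = \<Phi> w - integral\<^sup>L M g"
  using assms unfolding excess_values_def by blast

lemma excess_values_zero: "0 \<in> excess_values A"
proof -
  have "(\<lambda>_. 0) \<in> test_functions" "\<Phi> (\<lambda>_. 0) = 0"
    using subspace_0[OF subspace_test_functions] \<Phi>_zero by (simp_all add: zero_fun_def)
  then show ?thesis
    using excess_valuesI[OF _ dominated_zero, of A] by (simp add: cut_def)
qed

lemma excess_values_le: "a \<in> excess_values A \<Longrightarrow> a \<le> \<epsilon>"
  by (erule excess_valuesE) (use \<Phi>_le in force)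

lemma bdd_above_excess_values: "bdd_above (excess_values A)"
  using excess_values_le by (rule bdd_aboveI)

lemma excess_values_le_excess: "a \<in> excess_values A \<Longrightarrow> a \<le> excess A"
  unfolding excess_def by (rule cSup_upper[OF _ bdd_above_excess_values])

lemma excess_leI: "(\<And>a. a \<in> excess_values A \<Longrightarrow> a \<le> c) \<Longrightarrow> excess A \<le> c"
  unfolding excess_def using excess_values_zero by (intro cSup_least) blast+

lemma excess_nonneg: "0 \<le> excess A"
  by (rule excess_values_le_excess[OF excess_values_zero])

lemma excess_le: "excess A \<le> \<epsilon>"
  by (rule excess_leI[OF excess_values_le])

lemma cut_Un:
  fixes w :: "'a \<Rightarrow> 'c::monoid_add"
  assumes "A \<inter> B = {}"
  shows "cut (A \<union> B) w = cut A w + cut B w"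
  using assms by (auto simp: cut_def fun_eq_iff)

lemma cut_cut: "cut A (cut A w) = cut A w"
  by (auto simp: cut_def)

text \<open>Cutting a pair along A and B gives one inequality, pasting a pair supported in A with
  one supported in B gives the other.\<close>

lemma excess_additive:
  assumes A: "A \<in> sets M" and B: "B \<in> sets M" and disj: "A \<inter> B = {}"
  shows "excess (A \<union> B) = excess A + excess B"
proof (rule antisym)
  show "excess (A \<union> B) \<le> excess A + excess B"
  proof (rule excess_leI)
    fix a assume "a \<in> excess_values (A \<union> B)"
    then obtain w g where w: "w \<in> test_functions" and d: "dominated w g"
      and c: "cut (A \<union> B) w = w" "cut (A \<union> B) g = g" and a: "a = \<Phi> w - integral\<^sup>L M g"
      by (rule excess_valuesE)
    have piece: "\<Phi> (cut C w) - integral\<^sup>L M (cut C g) \<le> excess C" if "C \<in> sets M" for C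
    proof (rule excess_values_le_excess)
      show "\<Phi> (cut C w) - integral\<^sup>L M (cut C g) \<in> excess_values C"
        by (intro excess_valuesI cut_test_function[OF w that] dominated_cut[OF d that] cut_cut)
    qed
    have "\<Phi> w = \<Phi> (cut A w) + \<Phi> (cut B w)"
      using \<Phi>_add[OF cut_test_function[OF w A] cut_test_function[OF w B]] c(1) cut_Un[OF disj, of w] by simp
    moreover have "integral\<^sup>L M g = integral\<^sup>L M (cut A g + cut B g)"
      using c(2) cut_Un[OF disj, of g] by simp
    then have "integral\<^sup>L M g = integral\<^sup>L M (cut A g) + integral\<^sup>L M (cut B g)"
      using Bochner_Integration.integral_add[OF dominated_integrable[OF dominated_cut[OF d A]]
          dominated_integrable[OF dominated_cut[OF d B]]]
      by (simp add: plus_fun_def)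
    ultimately show "a \<le> excess A + excess B" using piece[OF A] piece[OF B] a by simp
  qed
next
  have sum_le: "a + b \<le> excess (A \<union> B)" if ab: "a \<in> excess_values A" "b \<in> excess_values B" for a b
  proof -
    obtain v g where v: "v \<in> test_functions" "dominated v g" "cut A v = v" "cut A g = g" "a = \<Phi> v - integral\<^sup>L M g"
      using ab(1) by (rule excess_valuesE)
    obtain w h where w: "w \<in> test_functions" "dominated w h" "cut B w = w" "cut B h = h" "b = \<Phi> w - integral\<^sup>L M h"
      using ab(2) by (rule excess_valuesE)
    have v0: "v t = 0" "g t = 0" if "t \<notin> A" for t
      using fun_cong[OF v(3), of t] fun_cong[OF v(4), of t] that by (simp_all add: cut_def)
    have w0: "w t = 0" "h t = 0" if "t \<notin> B" for t
      using fun_cong[OF w(3), of t] fun_cong[OF w(4), of t] that by (simp_all add: cut_def)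
    have AB: "t \<notin> A" if "t \<in> B" for t using disj that by blast
    have "(\<lambda>t. if t \<in> A then v t else w t) = v + w" "(\<lambda>t. if t \<in> A then g t else h t) = g + h"
      using v0 w0 AB by (force simp: fun_eq_iff)+
    then have "dominated (v + w) (g + h)" using dominated_glue[OF v(2) w(2) A] by simp
    moreover have "cut (A \<union> B) (v + w) = v + w" "cut (A \<union> B) (g + h) = g + h"
      using v0 w0 by (auto simp: fun_eq_iff cut_def)
    moreover have "v + w \<in> test_functions" using subspace_add[OF subspace_test_functions v(1) w(1)] .
    ultimately have "\<Phi> (v + w) - integral\<^sup>L M (g + h) \<in> excess_values (A \<union> B)"
      by (intro excess_valuesI)
    moreover have "\<Phi> (v + w) - integral\<^sup>L M (g + h) = a + b"
      using \<Phi>_add[OF v(1) w(1)] v(5) w(5)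
        Bochner_Integration.integral_add[OF dominated_integrable[OF v(2)] dominated_integrable[OF w(2)]]
      by (simp add: plus_fun_def)
    ultimately show ?thesis using excess_values_le_excess by simp
  qed
  have "excess A \<le> excess (A \<union> B) - b" if "b \<in> excess_values B" for b
  proof (rule excess_leI)
    fix a assume "a \<in> excess_values A"
    then show "a \<le> excess (A \<union> B) - b" using sum_le[OF _ that, of a] by simp
  qed
  then have "excess B \<le> excess (A \<union> B) - excess A"
  proof (intro excess_leI)
    fix b assume "b \<in> excess_values B"
    then have "excess A \<le> excess (A \<union> B) - b" by fact
    then show "b \<le> excess (A \<union> B) - excess A" by simp
  qed
  then show "excess A + excess B \<le> excess (A \<union> B)" by simp
qed

text \<open>Every multiple of w is dominated by 0, so \<Phi> is bounded above by \<epsilon> on the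
  whole line through w.\<close>

lemma \<Phi>_null_le:
  assumes w: "w \<in> test_functions" and ae: "AE t in M. w t = 0"
  shows "\<Phi> w \<le> 0"
proof -
  have "s * \<Phi> w \<le> \<epsilon>" for s
  proof -
    have "AE t in M. (0 :: 'b) = (s *\<^sub>R w) t"
      using ae by eventually_elim (simp add: scaleR_fun_def)
    then have "dominated (s *\<^sub>R w) (\<lambda>_. 0)" by (rule dominated_cong_AE[OF dominated_zero])
    then show ?thesis
      using \<Phi>_le[OF subspace_scale[OF subspace_test_functions w]] \<Phi>_scale[OF w] by fastforce
  qed
  note le = this
  show ?thesis
  proof (rule ccontr)
    assume "\<not> \<Phi> w \<le> 0"
    then show False using le[of "(\<epsilon> + 1) / \<Phi> w"] by simp
  qed
qed

lemma \<Phi>_null: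
  assumes w: "w \<in> test_functions" and ae: "AE t in M. w t = 0"
  shows "\<Phi> w = 0"
proof -
  have "AE t in M. ((-1) *\<^sub>R w) t = 0" using ae by (simp add: scaleR_fun_def)
  then have "\<Phi> ((-1) *\<^sub>R w) \<le> 0"
    by (rule \<Phi>_null_le[OF subspace_scale[OF subspace_test_functions w]])
  then show ?thesis using \<Phi>_null_le[OF w ae] \<Phi>_scale[OF w, of "-1"] by simp
qed

lemma AE_cut_null: "A \<in> null_sets M \<Longrightarrow> AE t in M. cut A w t = 0"
  by (auto simp: cut_def dest: AE_not_in elim: eventually_mono)

lemma excess_null:
  assumes A: "A \<in> null_sets M"
  shows "excess A = 0"
proof (rule antisym[OF excess_leI excess_nonneg])
  fix a assume "a \<in> excess_values A"
  then obtain w g where w: "w \<in> test_functions" "cut A w = w" "cut A g = g" "a = \<Phi> w - integral\<^sup>L M g"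
    by (rule excess_valuesE)
  have "integral\<^sup>L M g = 0" using AE_cut_null[OF A, of g] w(3) by (intro integral_eq_zero_AE) simp
  moreover have "\<Phi> w = 0" using AE_cut_null[OF A, of w] w(2) by (intro \<Phi>_null[OF w(1)]) simp
  ultimately show "a \<le> 0" using w(4) by simp
qed

lemma slice_null: "A \<in> null_sets M \<Longrightarrow> slice u A = 0"
  unfolding slice_def by (intro \<Phi>_null cut_const_test_function AE_cut_null) auto

lemma slice_additive:
  assumes "A \<in> sets M" "B \<in> sets M" "A \<inter> B = {}"
  shows "slice u (A \<union> B) = slice u A + slice u B"
  unfolding slice_def cut_Un[OF assms(3)] by (intro \<Phi>_add cut_const_test_function assms)

lemma slice_add: "A \<in> sets M \<Longrightarrow> slice (u + v) A = slice u A + slice v A"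
proof -
  assume A: "A \<in> sets M"
  have "cut A (\<lambda>_. u + v) = cut A (\<lambda>_. u) + cut A (\<lambda>_. v)" by (auto simp: cut_def)
  then show ?thesis unfolding slice_def using A by (simp add: \<Phi>_add cut_const_test_function)
qed

lemma slice_scale: "A \<in> sets M \<Longrightarrow> slice (c *\<^sub>R u) A = c * slice u A"
proof -
  assume A: "A \<in> sets M"
  have "cut A (\<lambda>_. c *\<^sub>R u) = c *\<^sub>R cut A (\<lambda>_. u)" by (auto simp: cut_def scaleR_fun_def)
  then show ?thesis unfolding slice_def using A by (simp add: \<Phi>_scale cut_const_test_function)
qed

text \<open>Maps live on the whole type, so the constant u and its cut to \<open>space M\<close> are
  different maps; they agree almost everywhere.\<close>

lemma slice_space: "slice u (space M) = \<phi> u"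
proof -
  define w where "w = cut (space M) (\<lambda>_. u)"
  have w: "w \<in> test_functions" unfolding w_def by (rule cut_const_test_function) simp
  have d: "(\<lambda>_. u) - w \<in> test_functions"
    by (rule subspace_diff[OF subspace_test_functions const_test_function w])
  have "AE t in M. ((\<lambda>_. u) - w) t = 0" by (auto simp: w_def cut_def)
  then have "\<Phi> ((\<lambda>_. u) - w) = 0" by (rule \<Phi>_null[OF d])
  then have "\<Phi> (\<lambda>_. u) = \<Phi> w" using \<Phi>_add[OF d w] by simp
  then show ?thesis by (simp add: slice_def w_def \<Phi>_const)
qed

lemma slice_le:
  assumes g: "integrable M g" and A: "A \<in> sets M" and le: "AE t in M. t \<in> A \<longrightarrow> f t (x + u) \<le> ereal (fx t + g t)"
  shows "slice u A \<le> (LINT t:A|M. g t) + excess A"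
proof -
  have i: "integrable M (cut A g)"
  proof -
    have "cut A g = (\<lambda>t. indicator A t *\<^sub>R g t)" by (auto simp: cut_def)
    then show ?thesis using integrable_mult_indicator[OF A g] by simp
  qed
  have "AE t in M. f t (x + cut A (\<lambda>_. u) t) \<le> ereal (fx t + cut A g t)"
    using le fx_eq by eventually_elim (auto simp: cut_def)
  then have "dominated (cut A (\<lambda>_. u)) (cut A g)"
    using i by (simp add: dominated_def)
  then have "\<Phi> (cut A (\<lambda>_. u)) - integral\<^sup>L M (cut A g) \<in> excess_values A"
    by (intro excess_valuesI cut_const_test_function[OF A] cut_cut)
  moreover have "integral\<^sup>L M (cut A g) = (LINT t:A|M. g t)"
    unfolding set_lebesgue_integral_def by (rule Bochner_Integration.integral_cong) (auto simp: cut_def)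
  ultimately show ?thesis using excess_values_le_excess unfolding slice_def by fastforce
qed


section \<open>Densities of the generated set functions\<close>

text \<open>The gap in the inequality \<open>slice_le\<close>: a charge, for dominated u, that
  stands in for the signed \<open>slice u\<close>.\<close>

definition slack :: "'b \<Rightarrow> ('a \<Rightarrow> real) \<Rightarrow> 'a set \<Rightarrow> real" where
  "slack u g A = (LINT t:A|M. g t) + excess A - slice u A"

lemma charge_excess: "charge M excess"
  by unfold_locales (auto intro: excess_additive excess_nonneg)

lemma charge_slack:
  assumes "dominated (\<lambda>_. u) g"
  shows "charge M (slack u g)"
proof
  have g: "integrable M g" using assms by (rule dominated_integrable)
  show "slack u g (A \<union> B) = slack u g A + slack u g B"
    if "A \<in> sets M" "B \<in> sets M" "A \<inter> B = {}" for A B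
    using set_integral_Un[OF that(3) set_integrable_of_integrable[OF g that(1)] set_integrable_of_integrable[OF g that(2)]]
      excess_additive[OF that] slice_additive[OF that]
    by (simp add: slack_def)
  show "0 \<le> slack u g A" if "A \<in> sets M" for A
  proof -
    have "AE t in M. t \<in> A \<longrightarrow> f t (x + u) \<le> ereal (fx t + g t)"
      using assms by (auto simp: dominated_def elim: eventually_mono)
    then show ?thesis using slice_le[OF g that] by (simp add: slack_def)
  qed
qed

lemma slack_null:
  assumes "A \<in> null_sets M"
  shows "slack u g A = 0"
proof -
  have "(LINT t:A|M. g t) = 0"
    unfolding set_lebesgue_integral_def
    by (rule integral_eq_zero_AE) (use AE_not_in[OF assms] in \<open>auto elim: eventually_mono\<close>)
  then show ?thesis using excess_null[OF assms] slice_null[OF assms] by (simp add: slack_def)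
qed

lemma ex_slice_density_dominated:
  assumes d: "dominated (\<lambda>_. u) g" and l: "has_density_part M excess l"
  obtains h where "has_density_part M (slice u) h"
proof -
  interpret slack: charge M "slack u g" by (rule charge_slack[OF d])
  obtain n where n: "has_density_part M (slack u g) n"
    using slack.ex_has_density_part[OF sigma_finite_measure_axioms slack_null] by blast
  have "has_density_part M (\<lambda>A. ((LINT t:A|M. g t) + excess A) + (-1) * slack u g A) (\<lambda>t. (g t + l t) + (-1) * n t)"
    by (intro has_density_part_add has_density_part_cmult has_density_part_set_integral dominated_integrable[OF d] l n)
  then have "has_density_part M (slice u) (\<lambda>t. (g t + l t) + (-1) * n t)"
    by (rule has_density_part_cong) (simp add: slack_def)
  then show thesis by (rule that)
qed

text \<open>u is a multiple of the difference of \<open>u0 + s u\<close> and \<open>u0\<close>,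
  which are both dominated.\<close>

lemma ex_slice_density:
  assumes l: "has_density_part M excess l"
  obtains h where "has_density_part M (slice u) h"
proof -
  obtain s g where s: "s > 0" "dominated (\<lambda>_. u0 + s *\<^sub>R u) g" using absorbing by blast
  obtain g0 where g0: "dominated (\<lambda>_. u0) g0" by (rule obtain_dominated_u0)
  obtain h1 where h1: "has_density_part M (slice (u0 + s *\<^sub>R u)) h1"
    by (rule ex_slice_density_dominated[OF s(2) l])
  obtain h0 where h0: "has_density_part M (slice u0) h0"
    by (rule ex_slice_density_dominated[OF g0 l])
  have "has_density_part M (\<lambda>A. inverse s * (slice (u0 + s *\<^sub>R u) A + (-1) * slice u0 A))
      (\<lambda>t. inverse s * (h1 t + (-1) * h0 t))"
    by (intro has_density_part_add has_density_part_cmult h1 h0)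
  then have "has_density_part M (slice u) (\<lambda>t. inverse s * (h1 t + (-1) * h0 t))"
    by (rule has_density_part_cong) (use s(1) in \<open>simp add: slice_add slice_scale\<close>)
  then show thesis by (rule that)
qed

text \<open>Where \<open>\<bar>f t (x + u)\<bar> \<le> k p(t)\<close>, the difference
  \<open>f t (x + u) - fx t\<close> is integrable and serves as its own majorant, so densities can
  be compared there. Over all k these sets exhaust the points where \<open>f t (x + u)\<close> is
  finite.\<close>

lemma slice_density_le:
  assumes l: "has_density_part M excess l" and G: "has_density_part M (slice u) h"
    and meas [measurable]: "(\<lambda>t. f t (x + u)) \<in> borel_measurable M"
    and nonminf: "AE t in M. f t (x + u) \<noteq> -\<infinity>"
  shows "AE t in M. ereal (fx t + h t) \<le> f t (x + u) + ereal (l t)"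
proof -
  \<comment> \<open>A positive integrable p replaces the constant 1, which is not integrable when
    the measure is infinite.\<close>
  obtain p :: "'a \<Rightarrow> real" where p [measurable]: "p \<in> borel_measurable M" and p0: "\<And>t. p t > 0" and pi: "integrable M p"
    using obtain_positive_integrable_function by metis
  have [measurable]: "fx \<in> borel_measurable M" using fx_integrable by simp
  have "AE t in M. \<bar>f t (x + u)\<bar> \<le> ereal (real k * p t) \<longrightarrow> h t \<le> real_of_ereal (f t (x + u)) - fx t + l t" for k
  proof -
    define A where "A = {t \<in> space M. \<bar>f t (x + u)\<bar> \<le> ereal (real k * p t)}"
    have A [measurable]: "A \<in> sets M" unfolding A_def by measurable
    define g where "g = (\<lambda>t. indicator A t * (real_of_ereal (f t (x + u)) - fx t))"
    have g: "integrable M g"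
    proof -
      have "integrable M (\<lambda>t. indicator A t * real_of_ereal (f t (x + u)))"
      proof (rule Bochner_Integration.integrable_bound)
        show "integrable M (\<lambda>t. real k * p t)" using pi by simp
        show "AE t in M. norm (indicator A t * real_of_ereal (f t (x + u))) \<le> norm (real k * p t)"
        proof (intro AE_I2)
          fix t
          have "\<bar>real_of_ereal (f t (x + u))\<bar> \<le> real k * p t" if "t \<in> A"
            using that unfolding A_def by (cases "f t (x + u)") auto
          then show "norm (indicator A t * real_of_ereal (f t (x + u))) \<le> norm (real k * p t)"
            using p0[of t] by (auto split: split_indicator simp: abs_mult)
        qed
      qed measurable
      moreover have "integrable M (\<lambda>t. indicator A t * fx t)"
        using integrable_mult_indicator[OF A fx_integrable] by simp
      ultimately have "integrable M (\<lambda>t. indicator A t * real_of_ereal (f t (x + u)) - indicator A t * fx t)"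
        by (rule Bochner_Integration.integrable_diff)
      then show ?thesis by (simp add: g_def right_diff_distrib)
    qed
    have fg: "t \<in> A \<longrightarrow> f t (x + u) \<le> ereal (fx t + g t)" for t
      unfolding g_def A_def by (cases "f t (x + u)") auto
    have "has_density_part M (\<lambda>B. (LINT t:B|M. g t) + excess B) (\<lambda>t. g t + l t)"
      by (intro has_density_part_add has_density_part_set_integral g l)
    then have "AE t in M. t \<in> A \<longrightarrow> h t \<le> g t + l t"
    proof (rule has_density_part_mono[OF G _ A])
      fix B assume B: "B \<in> sets M" "B \<subseteq> A"
      show "slice u B \<le> (LINT t:B|M. g t) + excess B"
        by (rule slice_le[OF g B(1)]) (use fg B(2) in auto)
    qed
    then show ?thesis using AE_space by eventually_elim (auto simp: A_def g_def)
  qed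
  then have "AE t in M. \<forall>k. \<bar>f t (x + u)\<bar> \<le> ereal (real k * p t) \<longrightarrow> h t \<le> real_of_ereal (f t (x + u)) - fx t + l t"
    unfolding AE_all_countable by blast
  with nonminf show ?thesis
  proof eventually_elim
    case (elim t)
    show ?case
    proof (cases "f t (x + u)")
      case (real r)
      obtain k :: nat where "\<bar>r\<bar> / p t \<le> real k" using real_arch_simple by blast
      then have "\<bar>r\<bar> \<le> real k * p t" using p0[of t] by (simp add: field_simps)
      then have "h t \<le> r - fx t + l t" using elim(2)[rule_format, of k] real by simp
      then show ?thesis using real by simp
    qed (use elim(1) in auto)
  qed
qed

lemma ex_densities:
  assumes meas: "\<And>u. (\<lambda>t. f t (x + u)) \<in> borel_measurable M"
    and nonminf: "\<And>u. AE t in M. f t (x + u) \<noteq> -\<infinity>"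
  obtains G l where "\<And>u. integrable M (G u)" "integrable M l" "\<And>t. 0 \<le> l t" "integral\<^sup>L M l \<le> \<epsilon>"
    "\<And>u v. AE t in M. G (u + v) t = G u t + G v t" "\<And>c u. AE t in M. G (c *\<^sub>R u) t = c * G u t"
    "\<And>u. AE t in M. ereal (fx t + G u t) \<le> f t (x + u) + ereal (l t)"
    "\<And>u g. dominated (\<lambda>_. u) g \<Longrightarrow> \<phi> u - integral\<^sup>L M (G u) \<le> \<epsilon> - integral\<^sup>L M l"
proof -
  interpret excess: charge M excess by (rule charge_excess)
  obtain l where l: "has_density_part M excess l" and l0: "\<And>t. 0 \<le> l t"
    using excess.ex_has_density_part[OF sigma_finite_measure_axioms excess_null] by blast
  have "\<forall>u. \<exists>h. has_density_part M (slice u) h" using ex_slice_density[OF l] by metis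
  then obtain G where G: "\<And>u. has_density_part M (slice u) (G u)" by metis
  have Gi: "integrable M (G u)" for u using G by (rule has_density_partD)
  have li: "integrable M l" using l by (rule has_density_partD)
  show thesis
  proof (rule that[OF Gi li l0])
    show "integral\<^sup>L M l \<le> \<epsilon>"
      using excess.has_density_part_le_charge[OF l] excess_le[of "space M"] by simp
    show "AE t in M. G (u + v) t = G u t + G v t" for u v
      by (rule has_density_part_unique[OF G], rule has_density_part_cong[OF has_density_part_add[OF G[of u] G[of v]]])
         (simp add: slice_add)
    show "AE t in M. G (c *\<^sub>R u) t = c * G u t" for c u
      by (rule has_density_part_unique[OF G], rule has_density_part_cong[OF has_density_part_cmult[OF G[of u]]])
         (simp add: slice_scale)
    show "AE t in M. ereal (fx t + G u t) \<le> f t (x + u) + ereal (l t)" for u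
      by (rule slice_density_le[OF l G meas nonminf])
    show "\<phi> u - integral\<^sup>L M (G u) \<le> \<epsilon> - integral\<^sup>L M l" if d: "dominated (\<lambda>_. u) g" for u g
    proof -
      interpret slack: charge M "slack u g" by (rule charge_slack[OF d])
      note gi = dominated_integrable[OF d]
      have "has_density_part M (\<lambda>A. ((LINT t:A|M. g t) + excess A) + (-1) * slice u A) (\<lambda>t. (g t + l t) + (-1) * G u t)"
        by (intro has_density_part_add has_density_part_cmult has_density_part_set_integral gi l G)
      then have "has_density_part M (slack u g) (\<lambda>t. (g t + l t) + (-1) * G u t)"
        by (rule has_density_part_cong) (simp add: slack_def)
      \<comment> \<open>The loss of mass is nonnegative. Written out, the integral of g cancels and
        the remainder of \<phi> is bounded by that of \<open>excess\<close>.\<close>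
      then have "integral\<^sup>L M (\<lambda>t. (g t + l t) + (-1) * G u t) \<le> slack u g (space M)"
        by (rule slack.has_density_part_le_charge)
      also have "slack u g (space M) = integral\<^sup>L M g + excess (space M) - \<phi> u"
        using gi by (simp add: slack_def slice_space set_integral_space)
      also have "integral\<^sup>L M (\<lambda>t. (g t + l t) + (-1) * G u t) = integral\<^sup>L M g + integral\<^sup>L M l - integral\<^sup>L M (G u)"
        using gi li Gi[of u] by simp
      finally show ?thesis using excess_le[of "space M"] by simp
    qed
  qed
qed

end

subsection \<open>Measurable families of subgradients\<close>

lemma dense_setD: "dense_set D \<Longrightarrow> open U \<Longrightarrow> u \<in> U \<Longrightarrow> \<exists>d\<in>D. d \<in> U"
  unfolding dense_set_def by blast

lemma dense_set_mono: "dense_set D \<Longrightarrow> D \<subseteq> D' \<Longrightarrow> dense_set D'"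
  unfolding dense_set_def by blast

section \<open>Countable rational spans and the collection of null sets\<close>

definition rat_multiples :: "'a::real_vector set \<Rightarrow> 'a set" where
  "rat_multiples C = (\<lambda>(q, c). q *\<^sub>R c) ` (\<rat> \<times> C)"

text \<open>Encoded by lists, so that countability follows from that of the lists over a countable
  set.\<close>

definition rat_span :: "'a::real_vector set \<Rightarrow> 'a set" where
  "rat_span C = sum_list ` lists (rat_multiples C)"

lemma rat_multiplesI: "q \<in> \<rat> \<Longrightarrow> c \<in> C \<Longrightarrow> q *\<^sub>R c \<in> rat_multiples C"
  unfolding rat_multiples_def by force

lemma scaleR_rat_multiples:
  assumes "q \<in> \<rat>" "b \<in> rat_multiples C"
  shows "q *\<^sub>R b \<in> rat_multiples C"
proof -
  obtain p c where "p \<in> \<rat>" "c \<in> C" "b = p *\<^sub>R c"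
    using assms(2) unfolding rat_multiples_def by auto
  then show ?thesis using rat_multiplesI[of "q * p" c C] assms(1) by simp
qed

lemma countable_rat_span: "countable C \<Longrightarrow> countable (rat_span C)"
  unfolding rat_span_def rat_multiples_def
  by (intro countable_image countable_lists countable_SIGMA countable_rat)

lemma sum_list_in_rat_span: "set xs \<subseteq> rat_multiples C \<Longrightarrow> sum_list xs \<in> rat_span C"
  unfolding rat_span_def by (rule imageI) (simp add: in_lists_conv_set subset_iff)

lemma rat_spanE:
  assumes "d \<in> rat_span C"
  obtains xs where "set xs \<subseteq> rat_multiples C" "d = sum_list xs"
  using assms unfolding rat_span_def lists_eq_set by blast

lemma subset_rat_span: "C \<subseteq> rat_span C"
proof
  fix c assume "c \<in> C"
  then have "1 *\<^sub>R c \<in> rat_multiples C" by (intro rat_multiplesI) simp_all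
  then show "c \<in> rat_span C" using sum_list_in_rat_span[of "[c]" C] by simp
qed

lemma rat_span_mono: "C \<subseteq> C' \<Longrightarrow> rat_span C \<subseteq> rat_span C'"
proof
  fix d assume C: "C \<subseteq> C'" and "d \<in> rat_span C"
  then obtain xs where xs: "set xs \<subseteq> rat_multiples C" "d = sum_list xs" by (elim rat_spanE)
  have "rat_multiples C \<subseteq> rat_multiples C'" using C by (auto simp: rat_multiples_def)
  then show "d \<in> rat_span C'" unfolding xs(2) using xs(1) by (intro sum_list_in_rat_span) simp
qed

lemma rat_subspace_rat_span: "rat_subspace (rat_span C)"
  unfolding rat_subspace_def
proof (intro conjI ballI)
  fix d d' assume "d \<in> rat_span C" "d' \<in> rat_span C"
  then obtain xs ys where "set xs \<subseteq> rat_multiples C" "d = sum_list xs"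
    "set ys \<subseteq> rat_multiples C" "d' = sum_list ys"
    by (elim rat_spanE)
  then show "d + d' \<in> rat_span C" using sum_list_in_rat_span[of "xs @ ys" C] by simp
next
  fix q :: real and d assume q: "q \<in> \<rat>" and "d \<in> rat_span C"
  then obtain xs where xs: "set xs \<subseteq> rat_multiples C" "d = sum_list xs"
    by (elim rat_spanE)
  have "set (map (\<lambda>b. q *\<^sub>R b) xs) \<subseteq> rat_multiples C"
    using scaleR_rat_multiples[OF q] xs(1) by auto
  then have "sum_list (map (\<lambda>b. q *\<^sub>R b) xs) \<in> rat_span C" by (rule sum_list_in_rat_span)
  moreover have "sum_list (map (\<lambda>b. q *\<^sub>R b) xs) = q *\<^sub>R sum_list xs"
    by (induction xs) (simp_all add: scaleR_add_right)
  ultimately show "q *\<^sub>R d \<in> rat_span C" using xs(2) by simp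
qed

lemma suslin_space_countable_dense:
  assumes "suslin_space TYPE('a::t2_space)"
  obtains C :: "'a::t2_space set" where "countable C" "dense_set C"
proof -
  obtain P :: "real topology" and g :: "real \<Rightarrow> 'a" where P: "separable_space P"
      and g: "continuous_map P euclidean g" "g ` topspace P = UNIV"
    using assms unfolding suslin_space_def by (elim exE conjE) (rule that)
  obtain C where C: "countable C" "C \<subseteq> topspace P" "P closure_of C = topspace P"
    using P unfolding separable_space_def by blast
  have "g ` C \<inter> U \<noteq> {}" if U: "open U" "U \<noteq> {}" for U
  proof -
    define T where "T = {p \<in> topspace P. g p \<in> U}"
    have T: "openin P T"
      using openin_continuous_map_preimage[OF g(1), of U] U(1) by (simp add: T_def)
    obtain y where y: "y \<in> U" using U(2) by blast
    have "y \<in> g ` topspace P" using g(2) by simp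
    then obtain p where p: "p \<in> topspace P" "g p = y" by blast
    have pT: "p \<in> T" using p y by (simp add: T_def)
    have "p \<in> P closure_of C" using p(1) C(3) by simp
    then have "\<forall>T. p \<in> T \<and> openin P T \<longrightarrow> (\<exists>y. y \<in> C \<and> y \<in> T)"
      unfolding in_closure_of by (rule conjunct2)
    then obtain c where c: "c \<in> C" "c \<in> T" using T pT by meson
    have "g c \<in> U" using c(2) by (simp add: T_def)
    then show ?thesis using c(1) by blast
  qed
  then have "dense_set (g ` C)" by (simp add: dense_set_def)
  then show thesis using that[of "g ` C"] C(1) by simp
qed

text \<open>
  The two alternatives on \<open>(X, T)\<close> enter the proof only through the possibility to collect the
  exceptional null sets of all elements of a dense rational subspace.
\<close>

definition AE_dense :: "'t measure \<Rightarrow> 'a::{real_vector, topological_space} set \<Rightarrow> bool" where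
  "AE_dense M D \<longleftrightarrow> rat_subspace D \<and> dense_set D \<and>
     (\<forall>P. (\<forall>d\<in>D. AE t in M. P d t) \<longrightarrow> (AE t in M. \<forall>d\<in>D. P d t))"

lemma AE_dense_rat_span:
  assumes "countable C" "dense_set C"
  shows "AE_dense M (rat_span C)"
  unfolding AE_dense_def AE_ball_countable[OF countable_rat_span[OF assms(1)]]
  using rat_subspace_rat_span dense_set_mono[OF assms(2) subset_rat_span] by simp

text \<open>Countability comes from T: the null singletons form a countable, hence null, union. At
  any other point each property that holds almost everywhere holds, because singletons are
  measurable.\<close>

lemma AE_dense_UNIV:
  assumes "is_nat_power_set_space M"
  shows "AE_dense M UNIV"
proof -
  obtain e :: "nat \<Rightarrow> 'a" where e: "bij_betw e UNIV (space M)" and sets: "sets M = Pow (space M)"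
    using assms unfolding is_nat_power_set_space_def by blast
  define Z where "Z = {t \<in> space M. {t} \<in> null_sets M}"
  have "countable (space M)" using e by (metis bij_betw_def countable_image countableI_type)
  then have "countable Z" unfolding Z_def by (rule countable_subset[rotated]) blast
  then have "(\<Union>t\<in>Z. {t}) \<in> null_sets M"
    by (rule null_sets_UN') (simp add: Z_def)
  then have Z: "Z \<in> null_sets M" by simp
  have "AE t in M. \<forall>d. P d t" if P: "\<And>d. AE t in M. P d t" for P :: "'b \<Rightarrow> 'a \<Rightarrow> bool"
    using AE_not_in[OF Z] AE_space
  proof eventually_elim
    case (elim t)
    have "P d t" for d
    proof (rule ccontr)
      assume "\<not> P d t"
      obtain N where N: "N \<in> null_sets M" "{t \<in> space M. \<not> P d t} \<subseteq> N"
        using P[of d] unfolding eventually_ae_filter by blast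
      have "{t} \<in> sets M" using sets elim(2) by simp
      moreover have "{t} \<subseteq> N" using N(2) elim(2) \<open>\<not> P d t\<close> by blast
      ultimately have "{t} \<in> null_sets M" by (rule null_sets_subset[OF N(1)])
      then show False using elim by (simp add: Z_def)
    qed
    then show ?case by blast
  qed
  then show ?thesis by (auto simp: AE_dense_def rat_subspace_def dense_set_def)
qed

text \<open>The larger sets \<open>D'\<close> allow any given vector to join the fixed D without
  losing the common null set.\<close>

lemma ex_AE_dense:
  assumes "suslin_space TYPE('a::hausdorff_locally_convex) \<or> is_nat_power_set_space M"
  obtains D :: "'a::hausdorff_locally_convex set" where "AE_dense M D" "\<And>u. \<exists>D'. AE_dense M D' \<and> D \<subseteq> D' \<and> u \<in> D'"
  using assms
proof
  assume "suslin_space TYPE('a)"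
  then obtain C :: "'a set" where C: "countable C" "dense_set C"
    by (rule suslin_space_countable_dense)
  show thesis
  proof (rule that[OF AE_dense_rat_span[OF C]])
    fix u :: 'a
    have "AE_dense M (rat_span (insert u C))"
      using C dense_set_mono[OF C(2), of "insert u C"] by (intro AE_dense_rat_span) auto
    moreover have "u \<in> rat_span (insert u C)" using subset_rat_span by blast
    moreover have "rat_span C \<subseteq> rat_span (insert u C)" by (rule rat_span_mono) blast
    ultimately show "\<exists>D'. AE_dense M D' \<and> rat_span C \<subseteq> D' \<and> u \<in> D'" by blast
  qed
next
  assume "is_nat_power_set_space M"
  then have "AE_dense M (UNIV :: 'a set)" by (rule AE_dense_UNIV)
  then show thesis by (intro that[of UNIV]) auto
qed

section \<open>From densities to a selection of continuous functionals\<close>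

lemma continuous_on_UNIV_nhds:
  "(\<And>w. (g \<longlongrightarrow> g w) (nhds w)) \<Longrightarrow> continuous_on UNIV g"
  by (simp add: continuous_on_def tendsto_at_iff_tendsto_nhds)

text \<open>The value of h at u may lie below its values at nearby points of D, so no direct limit
  works. But vectors near \<open>(1 - s) u + s z\<close> have the form
  \<open>(1 - s) u + s w\<close> with w in U; there convexity bounds h from above, points of D can
  be used, and s tends to 0 afterwards.\<close>

lemma dual_le_if_le_on_dense:
  fixes h :: "'a::hausdorff_locally_convex \<Rightarrow> ereal"
  assumes m: "m \<in> topological_dual" and D: "dense_set D" and h: "ereal_convex h" "h (x + u) \<noteq> -\<infinity>"
    and U: "open U" "z \<in> U" and bd: "\<And>v. v \<in> U \<Longrightarrow> h (x + v) \<le> ereal c"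
    and le: "\<And>d. d \<in> D \<Longrightarrow> ereal (a + m d) \<le> h (x + d) + ereal l"
  shows "ereal (a + m u) \<le> h (x + u) + ereal l"
proof (cases "h (x + u)")
  case (real b)
  interpret linear m using m by (simp add: topological_dual_def)
  have cont: "continuous_on UNIV m" using m by (simp add: topological_dual_def)
  have seg: "a + m ((1 - s) *\<^sub>R u + s *\<^sub>R z) \<le> (1 - s) * b + s * c + l" if s: "0 < s" "s \<le> 1" for s
  proof (rule ccontr)
    let ?y = "(1 - s) *\<^sub>R u + s *\<^sub>R z"
    let ?r = "(1 - s) * b + s * c + l - a"
    assume "\<not> a + m ?y \<le> (1 - s) * b + s * c + l"
    then have y: "?y \<in> {v. ?r < m v}" by simp
    have "open {v. ?r < m v}" using cont by (intro open_Collect_less continuous_on_const)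
    moreover have "open {v. inverse s *\<^sub>R (v - (1 - s) *\<^sub>R u) \<in> U}"
    proof -
      have "((\<lambda>v. inverse s *\<^sub>R (v - (1 - s) *\<^sub>R u)) \<longlongrightarrow> inverse s *\<^sub>R (w - (1 - s) *\<^sub>R u)) (nhds w)" for w
        by (intro tendsto_scaleR_lc tendsto_const tendsto_diff) (simp add: filterlim_ident)
      then have "continuous_on UNIV (\<lambda>v. inverse s *\<^sub>R (v - (1 - s) *\<^sub>R u))"
        by (rule continuous_on_UNIV_nhds)
      then show ?thesis using open_vimage[OF U(1)] by (simp add: vimage_def)
    qed
    moreover have "inverse s *\<^sub>R (?y - (1 - s) *\<^sub>R u) \<in> U" using s U(2) by simp
    ultimately obtain d where d: "d \<in> D" "?r < m d" "inverse s *\<^sub>R (d - (1 - s) *\<^sub>R u) \<in> U"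
      using dense_setD[OF D, of "{v. ?r < m v} \<inter> {v. inverse s *\<^sub>R (v - (1 - s) *\<^sub>R u) \<in> U}" ?y] y
      by (auto intro: open_Int)
    define w where "w = inverse s *\<^sub>R (d - (1 - s) *\<^sub>R u)"
    have "x + d = (1 - s) *\<^sub>R (x + u) + s *\<^sub>R (x + w)"
      using s by (simp add: w_def algebra_simps)
    then have "h (x + d) \<le> ereal (1 - s) * h (x + u) + ereal s * h (x + w)"
      using h(1) s unfolding ereal_convex_def by auto
    also have "\<dots> \<le> ereal (1 - s) * ereal b + ereal s * ereal c"
      using bd[of w] d(3) real s by (intro add_mono ereal_mult_left_mono) (auto simp: w_def)
    finally have "h (x + d) \<le> ereal ((1 - s) * b + s * c)" by simp
    then have "ereal (a + m d) \<le> ereal ((1 - s) * b + s * c) + ereal l"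
      using le[OF d(1)] by (meson add_right_mono order_trans)
    then show False using d(2) by simp
  qed
  \<comment> \<open>Along the segment the inequality is affine in s with slope \<open>K\<close>, so
    it persists at s = 0.\<close>
  define K where "K = m z - m u + b - c"
  have lin: "(a + m u - b - l) + s * K \<le> 0" if "0 < s" "s \<le> 1" for s
  proof -
    have "m ((1 - s) *\<^sub>R u + s *\<^sub>R z) = (1 - s) * m u + s * m z"
      by (simp only: add scale real_scaleR_def)
    then show ?thesis using seg[OF that] by (simp add: K_def algebra_simps)
  qed
  have "((\<lambda>s. (a + m u - b - l) + s * K) \<longlongrightarrow> (a + m u - b - l) + 0 * K) (at_right 0)"
    by (intro tendsto_intros)
  moreover have "\<forall>\<^sub>F s in at_right (0::real). (a + m u - b - l) + s * K \<le> 0"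
    using eventually_at_right_real[of 0 1] by (auto elim!: eventually_mono intro: lin)
  ultimately have "(a + m u - b - l) + 0 * K \<le> 0"
    by (rule tendsto_upperbound) simp
  then show ?thesis using real by simp
qed (use h(2) in auto)

lemma bounded_above_near_continuity_point:
  assumes "continuous_at_some_point h"
  obtains U z c where "open U" "z \<in> U" "\<forall>y\<in>U. h y < ereal c" "\<bar>h z\<bar> \<noteq> \<infinity>"
proof -
  obtain z where z: "\<bar>h z\<bar> \<noteq> \<infinity>" "isCont h z"
    using assms unfolding continuous_at_some_point_def by (elim exE conjE) (rule that)
  obtain r where r: "h z = ereal r" using z(1) by auto
  have lim: "(h \<longlongrightarrow> h z) (nhds z)"
    using z(2) unfolding isCont_def tendsto_at_iff_tendsto_nhds .
  have "h z < ereal (r + 1)" using r by simp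
  then have "\<forall>\<^sub>F y in nhds z. h y < ereal (r + 1)" by (rule order_tendstoD(2)[OF lim])
  then obtain U where U: "open U" "z \<in> U" "\<forall>y\<in>U. h y < ereal (r + 1)"
    unfolding eventually_nhds by (elim exE conjE) (rule that)
  show thesis by (rule that[OF U z(1)])
qed

lemma open_translation_vimage:
  fixes x :: "'a::hausdorff_locally_convex"
  assumes "open U"
  shows "open {v. x + v \<in> U}"
proof -
  have "((\<lambda>v. x + v) \<longlongrightarrow> x + w) (nhds w)" for w
    by (intro tendsto_add tendsto_const) (simp add: filterlim_ident)
  then have "continuous_on UNIV (\<lambda>v. x + v)"
    by (rule continuous_on_UNIV_nhds)
  then show ?thesis using open_vimage[OF assms] by (simp add: vimage_def)
qed

lemma zero_in_dual: "(\<lambda>_. 0) \<in> topological_dual"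
  by (simp add: topological_dual_def linear_iff)

text \<open>m(t) extends G from D. For u outside D the exceptional null set depends on u: D is
  enlarged to contain u, and the extension from the larger set coincides with m(t) by density of
  D.\<close>

lemma ex_dual_selection:
  fixes f :: "'t \<Rightarrow> 'a::hausdorff_locally_convex \<Rightarrow> ereal"
  assumes XT: "suslin_space TYPE('a) \<or> is_nat_power_set_space M"
    and cont: "\<forall>t\<in>space M. continuous_at_some_point (f t)"
    and conv: "AE t in M. ereal_convex (f t)" and nonminf: "AE t in M. \<forall>y. f t y \<noteq> -\<infinity>"
    and G_add: "\<And>u v. AE t in M. G (u + v) t = G u t + G v t"
    and G_scale: "\<And>c u. AE t in M. G (c *\<^sub>R u) t = c * G u t"
    and G_le: "\<And>u. AE t in M. ereal (fx t + G u t) \<le> f t (x + u) + ereal (l t)"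
  obtains m where "\<And>t. m t \<in> topological_dual" "\<And>u. AE t in M. m t u = G u t"
    "AE t in M. \<forall>u. ereal (fx t + m t u) \<le> f t (x + u) + ereal (l t)"
proof (rule ex_AE_dense[OF XT])
  fix D :: "'a set" assume D: "AE_dense M D" and D': "\<And>u. \<exists>D'. AE_dense M D' \<and> D \<subseteq> D' \<and> u \<in> D'"
  define good where "good = (\<lambda>D t. rat_linear_on D (\<lambda>d. G d t) \<and>
      (\<forall>d\<in>D. ereal (fx t + G d t) \<le> f t (x + d) + ereal (l t)))"
  have AE_good: "AE t in M. good D t" if D: "AE_dense M D" for D
  proof -
    have ball: "AE t in M. \<forall>d\<in>D. P d t" if "\<And>d. d \<in> D \<Longrightarrow> AE t in M. P d t" for P
      using D that unfolding AE_dense_def by blast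
    have "AE t in M. \<forall>d\<in>D. \<forall>d'\<in>D. G (d + d') t = G d t + G d' t"
      by (intro ball G_add)
    moreover have "AE t in M. \<forall>q\<in>\<rat>. \<forall>d\<in>D. G (q *\<^sub>R d) t = q * G d t"
      unfolding AE_ball_countable[OF countable_rat] by (intro ballI ball G_scale)
    moreover have "AE t in M. \<forall>d\<in>D. ereal (fx t + G d t) \<le> f t (x + d) + ereal (l t)"
      by (intro ball G_le)
    ultimately show ?thesis
      by eventually_elim (simp add: good_def rat_linear_on_def)
  qed
  have bounded: "\<exists>U z c. open U \<and> z \<in> U \<and> (\<forall>v\<in>U. f t (x + v) \<le> ereal c)" if t: "t \<in> space M" for t
  proof -
    obtain U z c where U: "open U" "z \<in> U" "\<forall>y\<in>U. f t y < ereal c" "\<bar>f t z\<bar> \<noteq> \<infinity>"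
      by (rule bounded_above_near_continuity_point[OF bspec[OF cont t]])
    have "z - x \<in> {v. x + v \<in> U}" using U(2) by simp
    moreover have "\<forall>v\<in>{v. x + v \<in> U}. f t (x + v) \<le> ereal c"
      using U(3) by (simp add: less_imp_le)
    ultimately show ?thesis
      by (intro exI[of _ "{v. x + v \<in> U}"] exI[of _ "z - x"] exI[of _ c] conjI open_translation_vimage[OF U(1)])
  qed
  have ext: "\<exists>m\<in>topological_dual. \<forall>d\<in>D. m d = G d t"
    if D: "AE_dense M D" and t: "good D t" "t \<in> space M" for D t
  proof -
    obtain U z c where U: "open U" "z \<in> U" and "\<forall>v\<in>U. f t (x + v) \<le> ereal c"
      using bounded[OF t(2)] by (elim exE conjE) (rule that)
    then have bd: "f t (x + v) \<le> ereal c" if "v \<in> U" for v using that by blast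
    \<comment> \<open>The upper bound of the integrand near its continuity point becomes an upper
      bound of G on D there.\<close>
    have Gc: "G d t \<le> c + l t - fx t" if "d \<in> D" "d \<in> U" for d
    proof -
      have "ereal (fx t + G d t) \<le> f t (x + d) + ereal (l t)" using t(1) that(1) by (simp add: good_def)
      also have "\<dots> \<le> ereal c + ereal (l t)" by (intro add_right_mono bd that(2))
      finally show ?thesis by simp
    qed
    have "U \<noteq> {}" using U(2) by blast
    have lin: "rat_linear_on D (\<lambda>d. G d t)" using t(1) by (simp add: good_def)
    have "rat_subspace D" "dense_set D" using D by (simp_all add: AE_dense_def)
    then show ?thesis
      using U(1) \<open>U \<noteq> {}\<close> Gc by (rule rat_linear_extends_to_dual[OF _ _ lin])
  qed
  \<comment> \<open>The zero functional as default keeps m(t) in the dual at every t, since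
    \<open>weak_star_integrable\<close> admits no exceptional set for this.\<close>
  define m where "m = (\<lambda>t. if good D t \<and> t \<in> space M
      then SOME m. m \<in> topological_dual \<and> (\<forall>d\<in>D. m d = G d t) else (\<lambda>_. 0))"
  have m: "m t \<in> topological_dual" "\<forall>d\<in>D. m t d = G d t" if "good D t" "t \<in> space M" for t
  proof -
    have "\<exists>m. m \<in> topological_dual \<and> (\<forall>d\<in>D. m d = G d t)" using ext[OF D that] by blast
    from someI_ex[OF this] show "m t \<in> topological_dual" "\<forall>d\<in>D. m t d = G d t"
      using that by (simp_all add: m_def)
  qed
  show thesis
  proof (rule that[of m])
    show "m t \<in> topological_dual" for t
      using m(1)[of t] zero_in_dual by (cases "good D t \<and> t \<in> space M") (auto simp: m_def)
    show "AE t in M. m t u = G u t" for u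
    proof -
      obtain D' where D'': "AE_dense M D'" "D \<subseteq> D'" "u \<in> D'" using D' by blast
      from AE_good[OF D] AE_good[OF D''(1)] AE_space show ?thesis
      proof eventually_elim
        case (elim t)
        obtain m' where m': "m' \<in> topological_dual" "\<forall>d\<in>D'. m' d = G d t"
          using ext[OF D''(1) elim(2,3)] by blast
        have "dense_set D" using D by (simp add: AE_dense_def)
        then have "m t = m'"
          using m[OF elim(1,3)] m' D''(2) by (intro dual_eq_if_eq_on_dense) auto
        then show ?case using m'(2) D''(3) by simp
      qed
    qed
    from AE_good[OF D] AE_space conv nonminf
    show "AE t in M. \<forall>u. ereal (fx t + m t u) \<le> f t (x + u) + ereal (l t)"
    proof eventually_elim
      case (elim t)
      obtain U z c where U: "open U" "z \<in> U" and "\<forall>v\<in>U. f t (x + v) \<le> ereal c"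
        using bounded[OF elim(2)] by (elim exE conjE) (rule that)
      then have bd: "f t (x + v) \<le> ereal c" if "v \<in> U" for v using that by blast
      have D: "dense_set D" using D by (simp add: AE_dense_def)
      have le: "ereal (fx t + m t d) \<le> f t (x + d) + ereal (l t)" if "d \<in> D" for d
        using elim(1) m(2)[OF elim(1,2)] that by (simp add: good_def)
      show ?case
        using elim(4) by (intro allI dual_le_if_le_on_dense[OF m(1)[OF elim(1,2)] D elim(3) _ U bd le]) auto
    qed
  qed
qed

subsection \<open>Subdifferentials of integral functions\<close>

lemma open_absorbing:
  fixes z :: "'a::hausdorff_locally_convex"
  assumes "open U" "z \<in> U"
  obtains s :: real where "s > 0" "z + s *\<^sub>R u \<in> U" "z - s *\<^sub>R u \<in> U"
proof -
  have lim: "((\<lambda>s. s *\<^sub>R u) \<longlongrightarrow> 0) (at_right (0::real))"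
    using tendsto_scaleR_lc[OF tendsto_ident_at[of "0::real" "{0<..}"] tendsto_const[of u]] by simp
  have "\<forall>\<^sub>F s in at_right (0::real). s > 0" by (rule eventually_at_right_less)
  moreover have "\<forall>\<^sub>F s in at_right (0::real). z + 1 *\<^sub>R (s *\<^sub>R u) \<in> U"
    by (rule eventually_in_open[OF tendsto_perturb_scaleR[OF lim] assms])
  moreover have "\<forall>\<^sub>F s in at_right (0::real). z + (-1) *\<^sub>R (s *\<^sub>R u) \<in> U"
    by (rule eventually_in_open[OF tendsto_perturb_scaleR[OF lim] assms])
  ultimately have "\<forall>\<^sub>F s in at_right (0::real). s > 0 \<and> z + s *\<^sub>R u \<in> U \<and> z - s *\<^sub>R u \<in> U"
    by eventually_elim simp
  then have "\<exists>s::real. s > 0 \<and> z + s *\<^sub>R u \<in> U \<and> z - s *\<^sub>R u \<in> U"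
    by (rule eventually_happens'[rotated]) simp
  then show thesis by (elim exE conjE) (rule that)
qed

section \<open>Upper integrals\<close>

lemma upper_integral_le:
  "integrable M g \<Longrightarrow> AE t in M. h t \<le> ereal (g t) \<Longrightarrow> upper_integral M h \<le> ereal (integral\<^sup>L M g)"
  unfolding upper_integral_def by (rule Inf_lower) blast

lemma upper_integral_lessE:
  assumes "upper_integral M h < c"
  obtains g where "integrable M g" "AE t in M. h t \<le> ereal (g t)" "ereal (integral\<^sup>L M g) < c"
proof -
  obtain a where a: "a \<in> {ereal (integral\<^sup>L M g) | g. integrable M g \<and> (AE t in M. h t \<le> ereal (g t))}" "a < c"
    using assms unfolding upper_integral_def Inf_less_iff by (elim bexE) (rule that)
  obtain g where "a = ereal (integral\<^sup>L M g)" "integrable M g" "AE t in M. h t \<le> ereal (g t)"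
    using a(1) by (elim CollectE exE conjE) (rule that)
  then show thesis using a(2) by (intro that) simp_all
qed

lemma upper_integral_greatest:
  assumes "\<And>g. integrable M g \<Longrightarrow> AE t in M. h t \<le> ereal (g t) \<Longrightarrow> c \<le> ereal (integral\<^sup>L M g)"
  shows "c \<le> upper_integral M h"
  unfolding upper_integral_def by (rule Inf_greatest) (elim CollectE exE conjE, simp add: assms)

text \<open>
  A non-integrable negative part would make the upper integral \<open>-\<infinity>\<close>: subtract the truncations of \<open>g - h\<close>
  from an integrable majorant \<open>g\<close>.
\<close>

lemma (in sigma_finite_measure) upper_integral_finiteE:
  assumes h [measurable]: "h \<in> borel_measurable M" and nonminf: "AE t in M. h t \<noteq> -\<infinity>"
    and fin: "\<bar>upper_integral M h\<bar> \<noteq> \<infinity>"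
  obtains k where "integrable M k" "AE t in M. h t = ereal (k t)" "upper_integral M h = ereal (integral\<^sup>L M k)"
proof -
  obtain i where i: "upper_integral M h = ereal i" using fin by auto
  have "upper_integral M h < \<infinity>" using i by simp
  then obtain g where g: "integrable M g" "AE t in M. h t \<le> ereal (g t)"
    by (rule upper_integral_lessE) (rule that)
  have [measurable]: "g \<in> borel_measurable M" using g(1) by simp
  obtain p :: "'a \<Rightarrow> real" where p [measurable]: "p \<in> borel_measurable M"
      and p0: "\<And>t. p t > 0" and pi: "integrable M p"
    using obtain_positive_integrable_function by metis
  define k where "k = (\<lambda>t. real_of_ereal (h t))"
  have [measurable]: "k \<in> borel_measurable M" unfolding k_def by measurable
  have hk: "AE t in M. h t = ereal (k t)"
    using nonminf g(2)
  proof eventually_elim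
    case (elim t)
    then show ?case unfolding k_def by (cases "h t") auto
  qed
  have gk: "AE t in M. k t \<le> g t" using hk g(2) by eventually_elim simp
  \<comment> \<open>Truncation at the level n p(t), integrable because almost everywhere it lies
    between 0 and n p(t).\<close>
  define d where "d = (\<lambda>n t. min (g t - k t) (real n * p t))"
  have dm [measurable]: "d n \<in> borel_measurable M" for n unfolding d_def by measurable
  have di: "integrable M (d n)" for n
  proof (rule Bochner_Integration.integrable_bound)
    show "integrable M (\<lambda>t. real n * p t)" using pi by simp
    show "AE t in M. norm (d n t) \<le> norm (real n * p t)"
      using gk
    proof eventually_elim
      case (elim t)
      have "0 \<le> real n * p t" using p0[of t] by (intro mult_nonneg_nonneg) auto
      then have "0 \<le> d n t" "d n t \<le> real n * p t" using elim by (simp_all add: d_def)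
      then show ?case by simp
    qed
  qed measurable
  define c where "c = (\<lambda>n. integral\<^sup>L M (d n))"
  have dmono: "d n t \<le> d (Suc n) t" for n t
  proof -
    have "real n * p t \<le> real (Suc n) * p t" using p0[of t] by (intro mult_right_mono) auto
    then show ?thesis unfolding d_def by (rule min.mono[OF order_refl])
  qed
  have inc: "incseq c"
    unfolding c_def by (intro incseq_SucI integral_mono di dmono)
  have bd: "\<forall>n. c n \<le> integral\<^sup>L M g - i"
  proof
    fix n
    \<comment> \<open>Subtracting the truncation leaves a majorant of h, which bounds the integrals
      \<open>c n\<close> by a constant.\<close>
    have "AE t in M. h t \<le> ereal (g t - d n t)"
      using hk by eventually_elim (simp add: d_def)
    then have "upper_integral M h \<le> ereal (integral\<^sup>L M (\<lambda>t. g t - d n t))"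
      using g(1) di by (intro upper_integral_le Bochner_Integration.integrable_diff)
    then show "c n \<le> integral\<^sup>L M g - i" using i g(1) di by (simp add: c_def)
  qed
  obtain L where L: "c \<longlonglongrightarrow> L"
    by (rule incseq_convergent[OF inc bd]) (rule that)
  have "integrable M (\<lambda>t. g t - k t)"
  proof (rule integrable_monotone_convergence[OF di _ _ L[unfolded c_def]])
    show "AE t in M. mono (\<lambda>n. d n t)"
      by (intro AE_I2 incseq_SucI dmono)
    show "AE t in M. (\<lambda>n. d n t) \<longlonglongrightarrow> g t - k t"
    proof (intro AE_I2)
      fix t
      obtain N :: nat where N: "(g t - k t) / p t \<le> real N" using real_arch_simple by blast
      have "d n t = g t - k t" if "n \<ge> N" for n
      proof -
        have "(g t - k t) / p t \<le> real n" using N that by linarith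
        then have "g t - k t \<le> real n * p t" using p0[of t] by (simp add: field_simps)
        then show ?thesis by (simp add: d_def)
      qed
      then show "(\<lambda>n. d n t) \<longlonglongrightarrow> g t - k t"
        by (intro tendsto_eventually) (auto simp: eventually_sequentially)
    qed
  qed measurable
  then have "integrable M (\<lambda>t. g t - (g t - k t))"
    by (rule Bochner_Integration.integrable_diff[OF g(1)])
  then have ki: "integrable M k" by simp
  moreover have "upper_integral M h = ereal (integral\<^sup>L M k)"
  proof (rule antisym)
    show "upper_integral M h \<le> ereal (integral\<^sup>L M k)"
      using hk by (intro upper_integral_le ki) auto
    show "ereal (integral\<^sup>L M k) \<le> upper_integral M h"
    proof (rule upper_integral_greatest)
      fix g assume g: "integrable M g" "AE t in M. h t \<le> ereal (g t)"
      have "AE t in M. k t \<le> g t" using hk g(2) by eventually_elim simp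
      then show "ereal (integral\<^sup>L M k) \<le> ereal (integral\<^sup>L M g)"
        using ki g(1) by (simp add: integral_mono_AE)
    qed
  qed
  ultimately show thesis by (intro that[OF _ hk])
qed

text \<open>Completeness enters here: the selection m is made by choice and agrees with the
  measurable densities only almost everywhere.\<close>

lemma (in complete_measure) borel_measurable_AE_eq:
  fixes g h :: "'a \<Rightarrow> real"
  assumes g: "g \<in> borel_measurable M" and eq: "AE t in M. h t = g t"
  shows "h \<in> borel_measurable M"
proof (rule measurableI)
  fix A :: "real set" assume A: "A \<in> sets borel"
  have gA: "g -` A \<inter> space M \<in> sets M" using g A by (rule measurable_sets)
  have "AE t in M. t \<in> g -` A \<inter> space M \<longleftrightarrow> t \<in> h -` A \<inter> space M"
    using eq by eventually_elim auto
  then show "h -` A \<inter> space M \<in> sets M" by (rule in_sets_AE[OF _ gA]) blast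
qed simp

text \<open>Convexity would spread the value: prolonging the segment from x through the continuity
  point z reaches some y with finite upper bound, and majorants at x of arbitrarily low integral
  would push the value at z below itself.\<close>

lemma integral_function_not_minf:
  fixes f :: "'t \<Rightarrow> 'a::hausdorff_locally_convex \<Rightarrow> ereal"
  assumes conv: "AE t in M. ereal_convex (f t)"
    and cont: "continuous_at_some_point (integral_function M f)"
  shows "integral_function M f x \<noteq> -\<infinity>"
proof
  assume x: "integral_function M f x = -\<infinity>"
  obtain U z c where U: "open U" "z \<in> U" "\<forall>y\<in>U. integral_function M f y < ereal c"
      and z: "\<bar>integral_function M f z\<bar> \<noteq> \<infinity>"
    by (rule bounded_above_near_continuity_point[OF cont])
  obtain r where r: "integral_function M f z = ereal r" using z by auto
  obtain s :: real where s: "s > 0" "z + s *\<^sub>R (z - x) \<in> U" by (rule open_absorbing[OF U(1,2)])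
  define y where "y = z + s *\<^sub>R (z - x)"
  have "integral_function M f y < ereal c" using U(3) s(2) by (simp add: y_def)
  then obtain h where h: "integrable M h" "AE t in M. f t y \<le> ereal (h t)"
    unfolding integral_function_def by (rule upper_integral_lessE)
  \<comment> \<open>The weight with z = (1 - a) y + a x.\<close>
  define a where "a = s / (1 + s)"
  have a: "0 < a" "a \<le> 1" "1 - a = 1 / (1 + s)" using s by (auto simp: a_def field_simps)
  have zy: "z = (1 - a) *\<^sub>R y + a *\<^sub>R x"
  proof -
    have "(1 + s) *\<^sub>R z = y + s *\<^sub>R x" by (simp add: y_def algebra_simps)
    then have "inverse (1 + s) *\<^sub>R ((1 + s) *\<^sub>R z) = inverse (1 + s) *\<^sub>R y + (inverse (1 + s) * s) *\<^sub>R x"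
      by (simp add: scaleR_right_distrib)
    then show ?thesis using s(1) a(3) by (simp add: a_def divide_inverse mult.commute)
  qed
  \<comment> \<open>The threshold makes the convex combination of h and g have integral below r -
    1.\<close>
  obtain g where g: "integrable M g" "AE t in M. f t x \<le> ereal (g t)"
      "ereal (integral\<^sup>L M g) < ereal ((r - 1 - (1 - a) * integral\<^sup>L M h) / a)"
    by (rule upper_integral_lessE[of M "\<lambda>t. f t x" "ereal ((r - 1 - (1 - a) * integral\<^sup>L M h) / a)"])
       (use x in \<open>simp add: integral_function_def\<close>)
  have "AE t in M. f t z \<le> ereal ((1 - a) * h t + a * g t)"
    using conv h(2) g(2)
  proof eventually_elim
    case (elim t)
    have "f t ((1 - a) *\<^sub>R y + a *\<^sub>R x) \<le> ereal (1 - a) * f t y + ereal a * f t x"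
      using elim(1) a(1,2) unfolding ereal_convex_def by simp
    then have "f t z \<le> ereal (1 - a) * f t y + ereal a * f t x" by (simp only: zy[symmetric])
    also have "\<dots> \<le> ereal (1 - a) * ereal (h t) + ereal a * ereal (g t)"
      using elim(2,3) a(1,2) by (intro add_mono ereal_mult_left_mono) simp_all
    finally show ?case by simp
  qed
  then have "integral_function M f z \<le> ereal (integral\<^sup>L M (\<lambda>t. (1 - a) * h t + a * g t))"
    unfolding integral_function_def using h(1) g(1) by (intro upper_integral_le) simp_all
  then have "r \<le> (1 - a) * integral\<^sup>L M h + a * integral\<^sup>L M g" using r h(1) g(1) by simp
  moreover have "a * integral\<^sup>L M g < r - 1 - (1 - a) * integral\<^sup>L M h"
    using g(3) a(1) by (simp add: pos_less_divide_eq mult.commute)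
  ultimately show False by simp
qed

section \<open>\<epsilon>-normals and the two inclusions\<close>

lemma eps_normal_setD:
  assumes "\<nu> \<in> eps_normal_set \<epsilon> A x"
  shows "x \<in> A" "\<nu> \<in> topological_dual" "y \<in> A \<Longrightarrow> \<nu> (y - x) \<le> \<epsilon>"
proof -
  show x: "x \<in> A"
    using assms by (auto simp: eps_normal_set_def eps_subdifferential_def set_indicator_def split: if_splits)
  then have *: "\<nu> \<in> topological_dual" "\<forall>y. ereal (\<nu> (y - x)) \<le> set_indicator A y - set_indicator A x + ereal \<epsilon>"
    using assms by (auto simp: eps_normal_set_def eps_subdifferential_def set_indicator_def split: if_splits)
  show "\<nu> \<in> topological_dual" by (rule *(1))
  show "\<nu> (y - x) \<le> \<epsilon>" if "y \<in> A"
    using *(2)[rule_format, of y] x that by (simp add: set_indicator_def)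
qed

lemma eps_normal_setI:
  assumes "x \<in> A" "\<nu> \<in> topological_dual" "\<And>y. y \<in> A \<Longrightarrow> \<nu> (y - x) \<le> \<epsilon>"
  shows "\<nu> \<in> eps_normal_set \<epsilon> A x"
  using assms by (auto simp: eps_normal_set_def eps_subdifferential_def set_indicator_def)

lemma dual_add:
  assumes "\<phi> \<in> topological_dual" "\<psi> \<in> topological_dual"
  shows "\<phi> + \<psi> \<in> topological_dual"
proof -
  have "linear (\<lambda>v. \<phi> v + \<psi> v)" "continuous_on UNIV (\<lambda>v. \<phi> v + \<psi> v)"
    using assms by (auto simp: topological_dual_def linear_compose_add continuous_on_add)
  then show ?thesis by (simp add: topological_dual_def plus_fun_def)
qed

text \<open>Upper integrals need not be additive, so the inequality is integrated through majorants:
  if g majorises the integrand at y, then g - m(y - x) + l majorises it at x.\<close>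

lemma weak_integral_plus_normal_in_subdifferential:
  fixes f :: "'t \<Rightarrow> 'a::hausdorff_locally_convex \<Rightarrow> ereal"
  assumes conv: "AE t in M. ereal_convex (f t)"
    and cont: "continuous_at_some_point (integral_function M f)"
    and m: "weak_star_integrable M m" "AE t in M. m t \<in> eps_subdifferential (l t) (f t) x"
      "weak_integral M m \<in> topological_dual"
    and l: "l \<in> nonneg_integrable_upto M \<epsilon>1"
    and \<nu>: "\<nu> \<in> eps_normal_set \<epsilon>2 (effective_domain (integral_function M f)) x"
  shows "weak_integral M m + \<nu> \<in> eps_subdifferential (\<epsilon>1 + \<epsilon>2) (integral_function M f) x"
proof -
  let ?I = "integral_function M f"
  have "?I x < \<infinity>" using eps_normal_setD(1)[OF \<nu>] by (simp add: effective_domain_def)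
  \<comment> \<open>Membership in the domain excludes only the value +\<infinity>.\<close>
  moreover have "?I x \<noteq> -\<infinity>" by (rule integral_function_not_minf[OF conv cont])
  ultimately obtain i where i: "?I x = ereal i" by (cases "?I x") auto
  have li: "integrable M l" "integral\<^sup>L M l \<le> \<epsilon>1" using l by (auto simp: nonneg_integrable_upto_def)
  have mi: "integrable M (\<lambda>t. m t u)" for u using m(1) by (simp add: weak_star_integrable_def)
  have low: "ereal (i + weak_integral M m (y - x) - \<epsilon>1) \<le> ?I y" for y
    unfolding integral_function_def
  proof (rule upper_integral_greatest)
    fix g assume g: "integrable M g" "AE t in M. f t y \<le> ereal (g t)"
    have "AE t in M. f t x \<le> ereal (g t - m t (y - x) + l t)"
      using m(2) g(2)
    proof eventually_elim
      case (elim t)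
      have fin: "\<bar>f t x\<bar> \<noteq> \<infinity>" using elim(1) by (simp add: eps_subdifferential_def split: if_splits)
      then have "ereal (m t (y - x)) \<le> f t y - f t x + ereal (l t)"
        using elim(1) by (simp add: eps_subdifferential_def)
      then show ?case using elim(2) fin by (cases "f t x"; cases "f t y") auto
    qed
    then have "?I x \<le> ereal (integral\<^sup>L M (\<lambda>t. g t - m t (y - x) + l t))"
      unfolding integral_function_def using g(1) mi li(1) by (intro upper_integral_le) simp_all
    then have "i \<le> integral\<^sup>L M g - weak_integral M m (y - x) + integral\<^sup>L M l"
      using i g(1) mi[of "y - x"] li(1) by (simp add: weak_integral_def)
    then show "ereal (i + weak_integral M m (y - x) - \<epsilon>1) \<le> ereal (integral\<^sup>L M g)"
      using li(2) by simp
  qed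
  have "ereal ((weak_integral M m + \<nu>) (y - x)) \<le> ?I y - ?I x + ereal (\<epsilon>1 + \<epsilon>2)" for y
  proof (cases "?I y")
    case (real r)
    then have "\<nu> (y - x) \<le> \<epsilon>2" using eps_normal_setD(3)[OF \<nu>, of y] by (simp add: effective_domain_def)
    moreover have "i + weak_integral M m (y - x) - \<epsilon>1 \<le> r" using low[of y] real by simp
    ultimately show ?thesis using real i by simp
  next
    case PInf
    then show ?thesis using i by simp
  next
    case MInf
    then show ?thesis using low[of y] by simp
  qed
  then show ?thesis
    using i dual_add[OF m(3) eps_normal_setD(2)[OF \<nu>]] by (simp add: eps_subdifferential_def)
qed

text \<open>The splitting of \<epsilon> is dictated by \<ell>: its integral is the first part, and
  the rest goes to the normal.\<close>

lemma subdifferential_decomposition: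
  fixes f :: "'t \<Rightarrow> 'a::hausdorff_locally_convex \<Rightarrow> ereal"
  assumes complete: "complete_measure M" and sf: "sigma_finite_measure M"
    and f: "convex_normal_integrand M f"
    and XT: "suslin_space TYPE('a) \<or> is_nat_power_set_space M"
    and cont_I: "continuous_at_some_point (integral_function M f)"
    and cont_f: "\<forall>t\<in>space M. continuous_at_some_point (f t)"
    and \<epsilon>: "0 \<le> \<epsilon>" and \<phi>: "\<phi> \<in> eps_subdifferential \<epsilon> (integral_function M f) x"
  shows "\<exists>m l \<nu>. weak_star_integrable M m \<and> (AE t in M. m t \<in> eps_subdifferential (l t) (f t) x) \<and>
    weak_integral M m \<in> topological_dual \<and> l \<in> nonneg_integrable_upto M (integral\<^sup>L M l) \<and>
    0 \<le> integral\<^sup>L M l \<and> integral\<^sup>L M l \<le> \<epsilon> \<and>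
    \<nu> \<in> eps_normal_set (\<epsilon> - integral\<^sup>L M l) (effective_domain (integral_function M f)) x \<and>
    \<phi> = weak_integral M m + \<nu>"
proof -
  interpret M: sigma_finite_measure M by (rule sf)
  interpret M: complete_measure M by (rule complete)
  let ?I = "integral_function M f"
  have conv: "AE t in M. ereal_convex (f t)" and proper: "AE t in M. proper (f t)"
    and fm: "case_prod f \<in> borel_measurable (M \<Otimes>\<^sub>M borel)"
    using f by (auto simp: convex_normal_integrand_def)
  have meas: "(\<lambda>t. f t y) \<in> borel_measurable M" for y
  proof -
    have "(\<lambda>t. (t, y)) \<in> measurable M (M \<Otimes>\<^sub>M borel)" by measurable
    from measurable_compose[OF this fm] show ?thesis by simp
  qed
  have nonminf: "AE t in M. \<forall>y. f t y \<noteq> -\<infinity>"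
    using proper by eventually_elim (simp add: proper_def)
  have Ix: "\<bar>?I x\<bar> \<noteq> \<infinity>" and \<phi>_dual: "\<phi> \<in> topological_dual"
    and \<phi>_sub: "\<And>y. ereal (\<phi> (y - x)) \<le> ?I y - ?I x + ereal \<epsilon>"
    using \<phi> by (auto simp: eps_subdifferential_def split: if_splits)
  have lin\<phi>: "linear \<phi>" using \<phi>_dual by (simp add: topological_dual_def)
  have "AE t in M. f t x \<noteq> -\<infinity>" using nonminf by eventually_elim simp
  then obtain fx where fx: "integrable M fx" "AE t in M. f t x = ereal (fx t)"
      and Ifx: "?I x = ereal (integral\<^sup>L M fx)"
    using Ix unfolding integral_function_def by (rule M.upper_integral_finiteE[OF meas])
  have dom_of_less: "\<exists>g. integrable M g \<and> (AE t in M. f t y \<le> ereal (fx t + g t))" if less: "?I y < c" for y c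
  proof -
    obtain g where g: "integrable M g" "AE t in M. f t y \<le> ereal (g t)"
      using less unfolding integral_function_def by (rule upper_integral_lessE) (rule that)
    then show ?thesis using fx(1) by (intro exI[of _ "\<lambda>t. g t - fx t"]) simp
  qed
  obtain U z c where U: "open U" "z \<in> U" "\<forall>y\<in>U. ?I y < ereal c" "\<bar>?I z\<bar> \<noteq> \<infinity>"
    by (rule bounded_above_near_continuity_point[OF cont_I])
  \<comment> \<open>The continuity point of the integral function as seen from x.\<close>
  define u0 where "u0 = z - x"
  have S: "integrand_subgradient M f x u0 fx \<phi> \<epsilon>"
  proof (rule integrand_subgradient.intro[OF sf], rule integrand_subgradient_axioms.intro)
    show "AE t in M. ereal_convex (f t)" "integrable M fx" "AE t in M. f t x = ereal (fx t)"
      "linear \<phi>" "0 \<le> \<epsilon>"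
      by (fact conv fx lin\<phi> \<epsilon>)+
  next
    fix u g assume d: "integrable M g \<and> (AE t in M. f t (x + u) \<le> ereal (fx t + g t))"
    then have "?I (x + u) \<le> ereal (integral\<^sup>L M (\<lambda>t. fx t + g t))"
      unfolding integral_function_def using fx(1) by (intro upper_integral_le) simp_all
    then have "?I (x + u) \<le> ereal (integral\<^sup>L M fx + integral\<^sup>L M g)"
      using d fx(1) by simp
    moreover have "ereal (\<phi> u) \<le> ?I (x + u) - ereal (integral\<^sup>L M fx) + ereal \<epsilon>"
      using \<phi>_sub[of "x + u"] Ifx by simp
    ultimately show "\<phi> u \<le> integral\<^sup>L M g + \<epsilon>" by (cases "?I (x + u)") auto
  next
    fix u
    obtain s :: real where s: "s > 0" "z + s *\<^sub>R u \<in> U" "z - s *\<^sub>R u \<in> U"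
      by (rule open_absorbing[OF U(1,2)])
    obtain g where g: "integrable M g" "AE t in M. f t (z + s *\<^sub>R u) \<le> ereal (fx t + g t)"
      using dom_of_less[OF bspec[OF U(3) s(2)]] by (elim exE conjE) (rule that)
    obtain h where h: "integrable M h" "AE t in M. f t (z - s *\<^sub>R u) \<le> ereal (fx t + h t)"
      using dom_of_less[OF bspec[OF U(3) s(3)]] by (elim exE conjE) (rule that)
    \<comment> \<open>One majorant has to serve both signs, hence the maximum.\<close>
    define k where "k = (\<lambda>t. max (g t) (h t))"
    have eq: "x + (u0 + s *\<^sub>R u) = z + s *\<^sub>R u" "x + (u0 - s *\<^sub>R u) = z - s *\<^sub>R u"
      by (simp_all add: u0_def)
    have "integrable M k" unfolding k_def using g(1) h(1) by (rule integrable_max)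
    moreover have "AE t in M. f t (x + (u0 + s *\<^sub>R u)) \<le> ereal (fx t + k t)"
      unfolding eq using g(2) by eventually_elim (erule order_trans, simp add: k_def)
    moreover have "AE t in M. f t (x + (u0 - s *\<^sub>R u)) \<le> ereal (fx t + k t)"
      unfolding eq using h(2) by eventually_elim (erule order_trans, simp add: k_def)
    ultimately show "\<exists>s>0. \<exists>g. (integrable M g \<and> (AE t in M. f t (x + (u0 + s *\<^sub>R u)) \<le> ereal (fx t + g t))) \<and>
        integrable M g \<and> (AE t in M. f t (x + (u0 - s *\<^sub>R u)) \<le> ereal (fx t + g t))"
      using s(1) by (intro exI[of _ s] exI[of _ k] conjI)
  qed
  show ?thesis
  proof (rule integrand_subgradient.ex_extension[OF S])
    fix \<Phi>
    assume \<Phi>: "\<And>u. \<Phi> (\<lambda>_. u) = \<phi> u"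
      "\<And>w g. w \<in> integrand_subgradient.test_functions M f x u0 fx \<Longrightarrow>
        integrable M g \<and> (AE t in M. f t (x + w t) \<le> ereal (fx t + g t)) \<Longrightarrow> \<Phi> w \<le> integral\<^sup>L M g + \<epsilon>"
      "\<And>v w. v \<in> integrand_subgradient.test_functions M f x u0 fx \<Longrightarrow> w \<in> integrand_subgradient.test_functions M f x u0 fx \<Longrightarrow> \<Phi> (v + w) = \<Phi> v + \<Phi> w"
      "\<And>c w. w \<in> integrand_subgradient.test_functions M f x u0 fx \<Longrightarrow> \<Phi> (c *\<^sub>R w) = c * \<Phi> w"
    have E: "integrand_extension M f x u0 fx \<phi> \<epsilon> \<Phi>"
      by (rule integrand_extension.intro[OF S], rule integrand_extension_axioms.intro) (fact \<Phi>)+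
    have nonminf': "AE t in M. f t (x + u) \<noteq> -\<infinity>" for u
      using nonminf by eventually_elim simp
    show ?thesis
    proof (rule integrand_extension.ex_densities[OF E meas nonminf'])
      fix G l
      assume Gi: "\<And>u. integrable M (G u)" and l: "integrable M l" "\<And>t. 0 \<le> l t" "integral\<^sup>L M l \<le> \<epsilon>"
        and G_add: "\<And>u v. AE t in M. G (u + v) t = G u t + G v t"
        and G_scale: "\<And>c u. AE t in M. G (c *\<^sub>R u) t = c * G u t"
        and G_le: "\<And>u. AE t in M. ereal (fx t + G u t) \<le> f t (x + u) + ereal (l t)"
        and G_dom: "\<And>u g. integrable M g \<and> (AE t in M. f t (x + u) \<le> ereal (fx t + g t)) \<Longrightarrow>
            \<phi> u - integral\<^sup>L M (G u) \<le> \<epsilon> - integral\<^sup>L M l"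
      show ?thesis
      proof (rule ex_dual_selection[OF XT cont_f conv nonminf G_add G_scale G_le])
        fix m
        assume m: "\<And>t. m t \<in> topological_dual" "\<And>u. AE t in M. m t u = G u t"
          "AE t in M. \<forall>u. ereal (fx t + m t u) \<le> f t (x + u) + ereal (l t)"
        have mlin: "linear (m t)" for t using m(1) by (simp add: topological_dual_def)
        have mm: "(\<lambda>t. m t u) \<in> borel_measurable M" for u
          by (rule M.borel_measurable_AE_eq[OF borel_measurable_integrable[OF Gi] m(2)])
        have mi: "integrable M (\<lambda>t. m t u)" for u
          by (rule integrable_cong_AE[THEN iffD2, OF mm borel_measurable_integrable[OF Gi] m(2) Gi])
        define \<psi> where "\<psi> = weak_integral M m"
        have \<psi>G: "\<psi> u = integral\<^sup>L M (G u)" for u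
          unfolding \<psi>_def weak_integral_def
          by (rule integral_cong_AE[OF mm borel_measurable_integrable[OF Gi] m(2)])
        have "linear \<psi>"
        proof (rule linearI)
          show "\<psi> (u + v) = \<psi> u + \<psi> v" for u v
            unfolding \<psi>_def weak_integral_def using mi by (simp add: linear_add[OF mlin])
          show "\<psi> (c *\<^sub>R u) = c *\<^sub>R \<psi> u" for c u
            unfolding \<psi>_def weak_integral_def by (simp add: linear_scale[OF mlin])
        qed
        define \<nu> where "\<nu> = (\<lambda>u. \<phi> u - \<psi> u)"
        have lin\<nu>: "linear \<nu>" unfolding \<nu>_def by (rule linear_compose_sub[OF lin\<phi> \<open>linear \<psi>\<close>])
        have \<nu>_le: "\<nu> (y - x) \<le> \<epsilon> - integral\<^sup>L M l" if less: "?I y < c" for y c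
        proof -
          obtain g where "integrable M g \<and> (AE t in M. f t y \<le> ereal (fx t + g t))"
            using dom_of_less[OF less] by (elim exE) (rule that)
          then show ?thesis using G_dom[of g "y - x"] by (simp add: \<nu>_def \<psi>G)
        qed
        \<comment> \<open>A weak integral need not be continuous. Here \<nu> is bounded above on a
          translate of U, hence continuous, and so is \<psi> = \<phi> - \<nu>.\<close>
        have \<nu>_dual: "\<nu> \<in> topological_dual"
        proof (rule linear_in_dual_if_bounded_above[OF lin\<nu> open_translation_vimage[OF U(1), of x]])
          show "u0 \<in> {v. x + v \<in> U}" using U(2) by (simp add: u0_def)
          show "\<nu> v \<le> \<epsilon> - integral\<^sup>L M l" if "v \<in> {v. x + v \<in> U}" for v
            using \<nu>_le[of "x + v"] U(3) that by auto
        qed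
        have "\<psi> = (\<lambda>u. \<phi> u - \<nu> u)" by (simp add: \<nu>_def)
        then have "continuous_on UNIV \<psi>"
          using \<phi>_dual \<nu>_dual by (simp add: topological_dual_def continuous_on_diff)
        then have \<psi>_dual: "\<psi> \<in> topological_dual"
          using \<open>linear \<psi>\<close> by (simp add: topological_dual_def)
        have "AE t in M. m t \<in> eps_subdifferential (l t) (f t) x"
          using m(3) fx(2)
        proof eventually_elim
          case (elim t)
          have "ereal (m t (y - x)) \<le> f t y - f t x + ereal (l t)" for y
            using elim(1)[rule_format, of "y - x"] elim(2) by (cases "f t y") auto
          then show ?case using elim(2) m(1) by (simp add: eps_subdifferential_def)
        qed
        moreover have "weak_star_integrable M m"
          using m(1) mi by (simp add: weak_star_integrable_def)
        moreover have "l \<in> nonneg_integrable_upto M (integral\<^sup>L M l)"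
          using l by (simp add: nonneg_integrable_upto_def)
        moreover have "0 \<le> integral\<^sup>L M l" using l(2) by simp
        moreover have "\<nu> \<in> eps_normal_set (\<epsilon> - integral\<^sup>L M l) (effective_domain ?I) x"
        proof (rule eps_normal_setI[OF _ \<nu>_dual])
          show "x \<in> effective_domain ?I" using Ix by (auto simp: effective_domain_def)
          show "\<nu> (y - x) \<le> \<epsilon> - integral\<^sup>L M l" if "y \<in> effective_domain ?I" for y
            using \<nu>_le[of y \<infinity>] that by (simp add: effective_domain_def)
        qed
        moreover have "\<phi> = weak_integral M m + \<nu>"
          unfolding \<psi>_def[symmetric] by (simp add: \<nu>_def fun_eq_iff)
        ultimately show ?thesis
          using \<psi>_dual l(3) unfolding \<psi>_def
          by (intro exI[of _ m] exI[of _ l] exI[of _ \<nu>] conjI)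
      qed
    qed
  qed
qed

theorem theorem2:
  fixes M :: "'t measure"
    and f :: "'t \<Rightarrow> 'a::hausdorff_locally_convex \<Rightarrow> ereal"
  assumes "complete_measure M"
    and "sigma_finite_measure M"
    and "convex_normal_integrand M f"
    and "suslin_space TYPE('a) \<or> is_nat_power_set_space M"
    and "continuous_at_some_point (integral_function M f)"
    and "\<And>t. t \<in> space M \<Longrightarrow> continuous_at_some_point (f t)"
  shows "\<forall>(x::'a) (\<epsilon>::real). 0 \<le> \<epsilon> \<longrightarrow>
    eps_subdifferential \<epsilon> (integral_function M f) x =
      \<Union> {weak_set_integral M (\<lambda>t. eps_subdifferential (l t) (f t) x)
            + eps_normal_set \<epsilon>2 (effective_domain (integral_function M f)) x
         | \<epsilon>1 \<epsilon>2 l. \<epsilon> = \<epsilon>1 + \<epsilon>2 \<and> 0 \<le> \<epsilon>1 \<and> 0 \<le> \<epsilon>2 \<and> l \<in> nonneg_integrable_upto M \<epsilon>1}"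
proof (intro allI impI set_eqI iffI)
  fix x :: 'a and \<epsilon> :: real and \<phi>
  have cont_f: "\<forall>t\<in>space M. continuous_at_some_point (f t)" using assms(6) by blast
  assume \<epsilon>: "0 \<le> \<epsilon>" and \<phi>: "\<phi> \<in> eps_subdifferential \<epsilon> (integral_function M f) x"
  obtain m l \<nu> where m: "weak_star_integrable M m" "AE t in M. m t \<in> eps_subdifferential (l t) (f t) x"
      "weak_integral M m \<in> topological_dual"
    and l: "l \<in> nonneg_integrable_upto M (integral\<^sup>L M l)" "0 \<le> integral\<^sup>L M l" "integral\<^sup>L M l \<le> \<epsilon>"
    and \<nu>: "\<nu> \<in> eps_normal_set (\<epsilon> - integral\<^sup>L M l) (effective_domain (integral_function M f)) x"
    and eq: "\<phi> = weak_integral M m + \<nu>"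
    using subdifferential_decomposition[OF assms(1-5) cont_f \<epsilon> \<phi>] by (elim exE conjE) (rule that)
  have "weak_integral M m \<in> weak_set_integral M (\<lambda>t. eps_subdifferential (l t) (f t) x)"
    using m unfolding weak_set_integral_def by blast
  then have "\<phi> \<in> weak_set_integral M (\<lambda>t. eps_subdifferential (l t) (f t) x)
      + eps_normal_set (\<epsilon> - integral\<^sup>L M l) (effective_domain (integral_function M f)) x"
    unfolding eq using \<nu> by (rule set_plus_intro)
  moreover have "\<epsilon> = integral\<^sup>L M l + (\<epsilon> - integral\<^sup>L M l)" "0 \<le> \<epsilon> - integral\<^sup>L M l" using l(3) by simp_all
  ultimately show "\<phi> \<in> \<Union> {weak_set_integral M (\<lambda>t. eps_subdifferential (l t) (f t) x)
            + eps_normal_set \<epsilon>2 (effective_domain (integral_function M f)) x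
         | \<epsilon>1 \<epsilon>2 l. \<epsilon> = \<epsilon>1 + \<epsilon>2 \<and> 0 \<le> \<epsilon>1 \<and> 0 \<le> \<epsilon>2 \<and> l \<in> nonneg_integrable_upto M \<epsilon>1}"
    using l(1,2) by (intro UnionI CollectI exI conjI) (assumption | rule refl)+
next
  fix x :: 'a and \<epsilon> :: real and \<phi>
  assume "\<phi> \<in> \<Union> {weak_set_integral M (\<lambda>t. eps_subdifferential (l t) (f t) x)
            + eps_normal_set \<epsilon>2 (effective_domain (integral_function M f)) x
         | \<epsilon>1 \<epsilon>2 l. \<epsilon> = \<epsilon>1 + \<epsilon>2 \<and> 0 \<le> \<epsilon>1 \<and> 0 \<le> \<epsilon>2 \<and> l \<in> nonneg_integrable_upto M \<epsilon>1}"
  then obtain \<epsilon>1 \<epsilon>2 l where \<epsilon>: "\<epsilon> = \<epsilon>1 + \<epsilon>2" and l: "l \<in> nonneg_integrable_upto M \<epsilon>1"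
    and "\<phi> \<in> weak_set_integral M (\<lambda>t. eps_subdifferential (l t) (f t) x)
      + eps_normal_set \<epsilon>2 (effective_domain (integral_function M f)) x"
    by (elim UnionE CollectE exE conjE) (rule that, simp_all only:)
  then obtain \<psi> \<nu> where \<psi>: "\<psi> \<in> weak_set_integral M (\<lambda>t. eps_subdifferential (l t) (f t) x)"
    and \<nu>: "\<nu> \<in> eps_normal_set \<epsilon>2 (effective_domain (integral_function M f)) x" and \<phi>: "\<phi> = \<psi> + \<nu>"
    by (elim set_plus_elim)
  obtain m where m: "\<psi> = weak_integral M m" "weak_star_integrable M m"
      "AE t in M. m t \<in> eps_subdifferential (l t) (f t) x" "weak_integral M m \<in> topological_dual"
    using \<psi> unfolding weak_set_integral_def by blast
  have "AE t in M. ereal_convex (f t)"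
    using assms(3) by (auto simp: convex_normal_integrand_def)
  then show "\<phi> \<in> eps_subdifferential \<epsilon> (integral_function M f) x"
    unfolding \<phi> m(1) \<epsilon>
    by (rule weak_integral_plus_normal_in_subdifferential[OF _ assms(5) m(2-4) l \<nu>])
qed

end
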